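(* Let $\mathrm{H}$ be a real Hilbert space. Let $f \in \Gamma_0(\cdot,\mathrm{H})$, let $x \in f^{-1}(\cdot,\mathbb{R})$ and let $v \in \partial f(0,x)$. Assume that the family $(\Delta^2_\tau f(x|v))_{\tau>0}$ admits a convergent supporting hyperplane $(z_\tau,\xi_\tau,\beta_\tau)_{\tau>0} \to (z,\xi,\beta)$. Then the following assertions are equivalent: (i) $f$ is twice epi-differentiable at $x$ for $v$; (ii) $\partial f$ is proto-differentiable at $x$ for $v$ and $D_p(\partial f)(x|v)$ is a maximal monotone operator. In that case, $d^2_e f(x|v)$ belongs to $\Gamma_0(\mathrm{H})$ with $\beta \le d^2_e f(x|v)(0) \le 0$, and $$D_p(\partial f)(x|v) = \partial\big(d^2_e f(x|v)\big).$$
   Context: Let $\mathrm{H}$ be a real Hilbert space with scalar product $\langle\cdot,\cdot\rangle$ and norm $\|\cdot\|$; $\mathbb{R}_+=[0,+\infty)$. Set limits (always as $\tau\to0$, $\tau>0$). For a family $(S_\tau)_{\tau>0}$ of subsets of a Hilbert space: $\limsup S_\tau$ (resp. $\mathrm{w}\text{-}\limsup S_\tau$) is the set of $x$ for which there exist positive $t_n\to0$ and $x_n\to x$ strongly (resp. weakly) with $x_n\in S_{t_n}$ for all $n$; $\liminf S_\tau$ is the set of $x$ such that for every positive sequence $t_n\to0$ there exist $x_n\to x$ strongly and $N$ with $x_n\in S_{t_n}$ for all $n\ge N$. The family is PK-convergent if $\limsup S_\tau\subset\liminf S_\tau$, and M-convergent (Mosco) if $\mathrm{w}\text{-}\limsup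 S_\tau\subset\liminf S_\tau$; in either case the limit is $\liminf S_\tau$. A family of set-valued maps $A_\tau:\mathrm{H}\rightrightarrows\mathrm{H}$ is G-convergent if the graphs $\mathrm{Gr}(A_\tau)=\{(x,y): y\in A_\tau(x)\}$ are PK-convergent in $\mathrm{H}\times\mathrm{H}$; its G-limit is the map whose graph is the limit. A family of functions $f_\tau:\mathrm{H}\to\mathbb{R}\cup\{\pm\infty\}$ is M-convergent if the epigraphs $\{(x,\lambda)\in\mathrm{H}\times\mathbb{R}: f_\tau(x)\le\lambda\}$ are M-convergent in $\mathrm{H}\times\mathbb{R}$; its limit is the function ($\mathrm{H}\to\mathbb{R}\cup\{\pm\infty\}$) whose epigraph is the limit. $\Gamma_0(\mathrm{H})$ is the set of proper, lower semi-continuous, convex functions $\mathrm{H}\to\mathbb{R}\cup\{+\infty\}$, with subdifferential $\partial f(x)=\{y:\langle y,z-x\rangle\le f(z)-f(x)\ \forall z\in\mathrm{H}\}$. $\Gamma_0(\cdot,\mathrm{H})$ is the set of $f:\mathbb{R}_+\times\mathrm{H}\to\mathbb{R}\cup\{+\infty\}$ with $f(t,\cdot)\in\Gamma_0(\mathrm{H})$ for all $t\ge0$; for such $f$, $\partial f(t,x):=\partial(f(t,\cdot))(x)$ and $f^{-1}(\cdot,\mathbb{R}):=\{x\in\mathrm{H}: f(t,x)\in\mathbb{R}\ \forall t\ge0\}$. Proto-differentiability: for $A:\mathbb{R}_+\times\mathrm{H}\rightrightarrows\mathrm{H}$, $x\in\mathrm{H}$, $v\in A(0,x)$, put $\Delta_\tau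 A(x|v)(w):=\frac{A(\tau,x+\tau w)-v}{\tau}$. $A$ is proto-differentiable at $x$ for $v$ if $(\Delta_\tau A(x|v))_{\tau>0}$ is G-convergent; the G-limit is denoted $D_pA(x|v):\mathrm{H}\rightrightarrows\mathrm{H}$. Twice epi-differentiability: for $f\in\Gamma_0(\cdot,\mathrm{H})$, $x\in f^{-1}(\cdot,\mathbb{R})$, $v\in\partial f(0,x)$, put $\Delta^2_\tau f(x|v)(w):=\frac{f(\tau,x+\tau w)-f(\tau,x)-\tau\langle v,w\rangle}{\tau^2}$ (for each $\tau>0$ this is a function of $w$ belonging to $\Gamma_0(\mathrm{H})$). $f$ is twice epi-differentiable at $x$ for $v$ if $(\Delta^2_\tau f(x|v))_{\tau>0}$ is M-convergent; the limit function is denoted $d^2_ef(x|v):\mathrm{H}\to\mathbb{R}\cup\{\pm\infty\}$. Supporting hyperplane: $(z,\xi,\beta)\in\mathrm{H}\times\mathrm{H}\times\mathbb{R}$ is a supporting hyperplane of $f\in\Gamma_0(\mathrm{H})$ if $f(w)\ge\langle\xi,w\rangle+\beta$ for all $w\in\mathrm{H}$ and $f(z)=\langle\xi,z\rangle+\beta$. A family $(f_\tau)_{\tau>0}$ in $\Gamma_0(\mathrm{H})$ admits a convergent supporting hyperplane $(z_\tau,\xi_\tau,\beta_\tau)_{\tau>0}\to(z,\xi,\beta)$ if $(z_\tau,\xi_\tau,\beta_\tau)$ is a supporting hyperplane of $f_\tau$ for every $\tau>0$ and $(z_\tau,\xi_\tau,\beta_\tau)\to(z,\xi,\beta)$ strongly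 in $\mathrm{H}\times\mathrm{H}\times\mathbb{R}$ as $\tau\to0$. *)

theory Defs
  imports "HOL-Analysis.Analysis"
begin

(* Conventions.  A Hilbert space is a type of sort {real_inner, complete_space}; products carry
   the library's product inner product.  Extended-real functions are ereal-valued and a set-valued
   map H => H is a function into sets.  A family (S_tau), tau > 0, or a map on R_+ is a function on
   all reals whose values at tau <= 0, respectively t < 0, are never used (the value at t = 0 is
   used for maps on R_+). *)

section \<open>Set limits as the parameter tends to 0 from the right\<close>

definition weakly_tendsto :: "(nat \<Rightarrow> 'a::real_inner) \<Rightarrow> 'a \<Rightarrow> bool" where
  "weakly_tendsto X x \<longleftrightarrow> (\<forall>y. (\<lambda>n. X n \<bullet> y) \<longlonglongrightarrow> x \<bullet> y)"

definition set_limsup :: "(real \<Rightarrow> 'a::real_inner set) \<Rightarrow> 'a set" where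
  "set_limsup S = {x. \<exists>t X. (\<forall>n. t n > 0) \<and> t \<longlonglongrightarrow> 0 \<and> X \<longlonglongrightarrow> x \<and> (\<forall>n. X n \<in> S (t n))}"

definition set_wlimsup :: "(real \<Rightarrow> 'a::real_inner set) \<Rightarrow> 'a set" where
  "set_wlimsup S =
     {x. \<exists>t X. (\<forall>n. t n > 0) \<and> t \<longlonglongrightarrow> 0 \<and> weakly_tendsto X x \<and> (\<forall>n. X n \<in> S (t n))}"

definition set_liminf :: "(real \<Rightarrow> 'a::real_inner set) \<Rightarrow> 'a set" where
  "set_liminf S =
     {x. \<forall>t. (\<forall>n. t n > 0) \<and> t \<longlonglongrightarrow> 0 \<longrightarrow> (\<exists>X. X \<longlonglongrightarrow> x \<and> (\<exists>N. \<forall>n\<ge>N. X n \<in> S (t n)))}"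

definition PK_convergent :: "(real \<Rightarrow> 'a::real_inner set) \<Rightarrow> bool" where
  "PK_convergent S \<longleftrightarrow> set_limsup S \<subseteq> set_liminf S"

definition M_convergent :: "(real \<Rightarrow> 'a::real_inner set) \<Rightarrow> bool" where
  "M_convergent S \<longleftrightarrow> set_wlimsup S \<subseteq> set_liminf S"


section \<open>Set-valued maps\<close>

definition graph_of :: "('a \<Rightarrow> 'b set) \<Rightarrow> ('a \<times> 'b) set" where
  "graph_of A = {(x, y). y \<in> A x}"

definition G_convergent :: "(real \<Rightarrow> 'a::real_inner \<Rightarrow> 'a set) \<Rightarrow> bool" where
  "G_convergent A \<longleftrightarrow> PK_convergent (\<lambda>\<tau>. graph_of (A \<tau>))"

definition G_limit :: "(real \<Rightarrow> 'a::real_inner \<Rightarrow> 'a set) \<Rightarrow> 'a \<Rightarrow> 'a set" where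
  "G_limit A x = {y. (x, y) \<in> set_liminf (\<lambda>\<tau>. graph_of (A \<tau>))}"

definition monotone_operator :: "('a::real_inner \<Rightarrow> 'a set) \<Rightarrow> bool" where
  "monotone_operator A \<longleftrightarrow>
     (\<forall>x1 y1 x2 y2. y1 \<in> A x1 \<and> y2 \<in> A x2 \<longrightarrow> (y1 - y2) \<bullet> (x1 - x2) \<ge> 0)"

definition maximal_monotone :: "('a::real_inner \<Rightarrow> 'a set) \<Rightarrow> bool" where
  "maximal_monotone A \<longleftrightarrow>
     monotone_operator A \<and>
     (\<forall>B. monotone_operator B \<and> graph_of A \<subseteq> graph_of B \<longrightarrow> graph_of B = graph_of A)"


section \<open>Extended-real-valued functions\<close>

definition epi :: "('a \<Rightarrow> ereal) \<Rightarrow> ('a \<times> real) set" where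
  "epi f = {(x, l). f x \<le> ereal l}"

(* The epigraph determines the function. *)
lemma epi_inject: "epi f = epi g \<longleftrightarrow> f = g"
proof
  assume eq: "epi f = epi g"
  have *: "f x \<le> ereal l \<longleftrightarrow> g x \<le> ereal l" for x l
  proof -
    have "(x, l) \<in> epi f \<longleftrightarrow> (x, l) \<in> epi g" by (simp only: eq)
    then show ?thesis by (simp add: epi_def)
  qed
  show "f = g"
  proof
    fix x
    have "f x \<le> g x" by (rule ereal_le_real) (use * in auto)
    moreover have "g x \<le> f x" by (rule ereal_le_real) (use * in auto)
    ultimately show "f x = g x" by (rule antisym)
  qed
qed simp

definition M_convergent_fun :: "(real \<Rightarrow> 'a::real_inner \<Rightarrow> ereal) \<Rightarrow> bool" where
  "M_convergent_fun f \<longleftrightarrow> M_convergent (\<lambda>\<tau>. epi (f \<tau>))"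

(* The lower set limit of epigraphs is closed and stable under increasing the second component,
   hence is itself the epigraph of exactly one function, so the description is well defined. *)
definition M_limit_fun :: "(real \<Rightarrow> 'a::real_inner \<Rightarrow> ereal) \<Rightarrow> 'a \<Rightarrow> ereal" where
  "M_limit_fun f = (THE g. epi g = set_liminf (\<lambda>\<tau>. epi (f \<tau>)))"

definition proper_fun :: "('a \<Rightarrow> ereal) \<Rightarrow> bool" where
  "proper_fun f \<longleftrightarrow> (\<forall>x. f x \<noteq> -\<infinity>) \<and> (\<exists>x. f x \<noteq> \<infinity>)"

definition lsc_fun :: "('a::topological_space \<Rightarrow> ereal) \<Rightarrow> bool" where
  "lsc_fun f \<longleftrightarrow> (\<forall>x. f x \<le> Liminf (at x) f)"

definition convex_fun :: "('a::real_vector \<Rightarrow> ereal) \<Rightarrow> bool" where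
  "convex_fun f \<longleftrightarrow>
     (\<forall>x y u. 0 < u \<and> u < 1 \<longrightarrow>
        f ((1 - u) *\<^sub>R x + u *\<^sub>R y) \<le> ereal (1 - u) * f x + ereal u * f y)"

definition Gamma0 :: "('a::real_inner \<Rightarrow> ereal) set" where
  "Gamma0 = {f. proper_fun f \<and> lsc_fun f \<and> convex_fun f}"

(* For proper f this is empty outside the domain of f: there f z - f x is minus infinity as soon
   as f z is finite, while the undetermined difference of two infinities evaluates to infinity in
   ereal and imposes no condition. *)
definition subdiff :: "('a::real_inner \<Rightarrow> ereal) \<Rightarrow> 'a \<Rightarrow> 'a set" where
  "subdiff f x = {y. \<forall>z. ereal (y \<bullet> (z - x)) \<le> f z - f x}"

definition supporting_hyperplane ::
    "('a::real_inner \<Rightarrow> ereal) \<Rightarrow> 'a \<Rightarrow> 'a \<Rightarrow> real \<Rightarrow> bool" where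
  "supporting_hyperplane f z \<xi> \<beta> \<longleftrightarrow>
     (\<forall>w. f w \<ge> ereal (\<xi> \<bullet> w + \<beta>)) \<and> f z = ereal (\<xi> \<bullet> z + \<beta>)"

definition convergent_supporting_hyperplane ::
    "(real \<Rightarrow> 'a::real_inner \<Rightarrow> ereal) \<Rightarrow> (real \<Rightarrow> 'a) \<Rightarrow> (real \<Rightarrow> 'a) \<Rightarrow> (real \<Rightarrow> real) \<Rightarrow>
      'a \<Rightarrow> 'a \<Rightarrow> real \<Rightarrow> bool" where
  "convergent_supporting_hyperplane f zf \<xi>f \<beta>f z \<xi> \<beta> \<longleftrightarrow>
     (\<forall>\<tau>>0. supporting_hyperplane (f \<tau>) (zf \<tau>) (\<xi>f \<tau>) (\<beta>f \<tau>)) \<and>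
     (zf \<longlongrightarrow> z) (at_right 0) \<and> (\<xi>f \<longlongrightarrow> \<xi>) (at_right 0) \<and> (\<beta>f \<longlongrightarrow> \<beta>) (at_right 0)"


section \<open>Parameterized functions and generalized derivatives\<close>

definition Gamma0_param :: "(real \<Rightarrow> 'a::real_inner \<Rightarrow> ereal) set" where
  "Gamma0_param = {f. \<forall>t\<ge>0. f t \<in> Gamma0}"

definition subdiff_param :: "(real \<Rightarrow> 'a::real_inner \<Rightarrow> ereal) \<Rightarrow> real \<Rightarrow> 'a \<Rightarrow> 'a set" where
  "subdiff_param f t x = subdiff (f t) x"

definition finite_points :: "(real \<Rightarrow> 'a \<Rightarrow> ereal) \<Rightarrow> 'a set" where
  "finite_points f = {x. \<forall>t\<ge>0. f t x \<in> range ereal}"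

definition diff_quot ::
    "(real \<Rightarrow> 'a::real_inner \<Rightarrow> 'a set) \<Rightarrow> 'a \<Rightarrow> 'a \<Rightarrow> real \<Rightarrow> 'a \<Rightarrow> 'a set" where
  "diff_quot A x v \<tau> w = (\<lambda>y. (y - v) /\<^sub>R \<tau>) ` A \<tau> (x + \<tau> *\<^sub>R w)"

definition proto_differentiable ::
    "(real \<Rightarrow> 'a::real_inner \<Rightarrow> 'a set) \<Rightarrow> 'a \<Rightarrow> 'a \<Rightarrow> bool" where
  "proto_differentiable A x v \<longleftrightarrow> G_convergent (diff_quot A x v)"

definition proto_deriv ::
    "(real \<Rightarrow> 'a::real_inner \<Rightarrow> 'a set) \<Rightarrow> 'a \<Rightarrow> 'a \<Rightarrow> 'a \<Rightarrow> 'a set" where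
  "proto_deriv A x v = G_limit (diff_quot A x v)"

definition second_diff_quot ::
    "(real \<Rightarrow> 'a::real_inner \<Rightarrow> ereal) \<Rightarrow> 'a \<Rightarrow> 'a \<Rightarrow> real \<Rightarrow> 'a \<Rightarrow> ereal" where
  "second_diff_quot f x v \<tau> w =
     (f \<tau> (x + \<tau> *\<^sub>R w) - f \<tau> x - ereal (\<tau> * (v \<bullet> w))) / ereal (\<tau>\<^sup>2)"

definition twice_epi_differentiable ::
    "(real \<Rightarrow> 'a::real_inner \<Rightarrow> ereal) \<Rightarrow> 'a \<Rightarrow> 'a \<Rightarrow> bool" where
  "twice_epi_differentiable f x v \<longleftrightarrow> M_convergent_fun (second_diff_quot f x v)"

definition second_epi_deriv ::
    "(real \<Rightarrow> 'a::real_inner \<Rightarrow> ereal) \<Rightarrow> 'a \<Rightarrow> 'a \<Rightarrow> 'a \<Rightarrow> ereal" where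
  "second_epi_deriv f x v = M_limit_fun (second_diff_quot f x v)"

end

(* Attouch's theorem applied to the second-order difference quotients F t, whose subdifferentials
   are the difference quotients of the subdifferential of f.  Everything is done along null
   sequences t n.  The supporting hyperplanes make the set limit of the epigraphs of F (t n) the
   epigraph of some h in Gamma0, and limits of subgradients of F (t n) are subgradients of h.

   If the family is Mosco convergent, weak compactness and the weak closedness of the limit
   epigraph show that the resolvents converge strongly, so that every subgradient of h is a limit.
   Conversely, a maximal monotone graph limit A must equal the subdifferential of h.  Since the
   hyperplanes also fix h z, and a convex function is determined by its subdifferential and one
   value, h does not depend on the sequence; and a weak limit of points of the epigraphs lies above
   all tangents of h, hence in its epigraph. *)
theory Submission
  imports Defs "HOL-Library.Diagonal_Subsequence"
begin

section \<open>Epigraphs and subdifferentials\<close>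

text \<open>The obstacle is the gap between strong and weak topology: set limits of graphs are
  strong, whereas points at which subgradients are taken are a priori only weakly compact.
  Resolvents close the gap, since the quadratic term in their defining inequality controls norms as
  well as inner products. For this they must be bounded uniformly in n, and this is a further use of
  the hyperplanes: the contact point and slope of each hyperplane form a point of the graph of the
  subdifferential, and resolvents are nonexpansive. Functions are treated through their epigraphs,
  as closed convex subsets of the product with the reals, which keeps the arithmetic real and
  matches the way the set limits are defined. A single minimisation of
  \<open>k + c * |w - u|^2\<close> over such a set supplies the resolvents, the projection onto a
  closed subspace and the Riesz representation.\<close>

lemma lsc_fun_iff_closed_epi:
  fixes f :: "'a::metric_space \<Rightarrow> ereal"
  shows "lsc_fun f \<longleftrightarrow> closed (epi f)"
proof
  assume lsc: "lsc_fun f"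
  show "closed (epi f)"
    unfolding closed_sequential_limits
  proof (intro allI impI, elim conjE)
    fix X :: "nat \<Rightarrow> 'a \<times> real" and xl
    assume X: "\<forall>n. X n \<in> epi f" and lim: "X \<longlonglongrightarrow> xl"
    obtain x l where xl: "xl = (x, l)" by fastforce
    have l1: "(\<lambda>n. fst (X n)) \<longlonglongrightarrow> x" and l2: "(\<lambda>n. snd (X n)) \<longlonglongrightarrow> l"
      using tendsto_fst[OF lim] tendsto_snd[OF lim] xl by auto
    have "f x \<le> ereal l"
    proof (rule ccontr)
      assume "\<not> f x \<le> ereal l"
      then obtain a where a: "ereal l < ereal a" "ereal a < f x"
        using ereal_dense2[of "ereal l" "f x"] by (meson not_le)
      have "eventually (\<lambda>y. ereal a < f y) (at x)"
        using lsc a(2) unfolding lsc_fun_def le_Liminf_iff by blast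
      \<comment> \<open>\<open>Liminf (at x)\<close> ignores the point \<open>x\<close> itself; the
        strict bound at \<open>x\<close> fills the hole.\<close>
      then have "eventually (\<lambda>y. ereal a < f y) (nhds x)"
        using a(2) by (auto simp: eventually_at_filter elim!: eventually_mono)
      then have "eventually (\<lambda>n. ereal a < f (fst (X n))) sequentially"
        by (rule eventually_compose_filterlim[OF _ l1])
      moreover have "eventually (\<lambda>n. snd (X n) < a) sequentially"
        using l2 a(1) order_tendstoD(2) by auto
      ultimately have "eventually (\<lambda>n. False) sequentially"
      proof eventually_elim
        case (elim n)
        have "f (fst (X n)) \<le> ereal (snd (X n))"
          using X by (auto simp: epi_def split: prod.splits dest: spec[of _ n])
        with elim have "ereal a < ereal (snd (X n))" by order
        with elim show ?case by simp
      qed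
      then show False by simp
    qed
    then show "xl \<in> epi f" by (simp add: epi_def xl)
  qed
next
  assume cl: "closed (epi f)"
  show "lsc_fun f"
    unfolding lsc_fun_def le_Liminf_iff
  proof (intro allI impI)
    fix x y assume "y < f x"
    then obtain r where r: "y < ereal r" "ereal r < f x" using ereal_dense2 by blast
    have "open ((\<lambda>w. (w, r)) -` (- epi f))"
      using cl by (intro open_vimage) (auto intro!: continuous_intros)
    moreover have "x \<in> (\<lambda>w. (w, r)) -` (- epi f)" using r by (simp add: epi_def)
    ultimately have "eventually (\<lambda>w. w \<in> (\<lambda>w. (w, r)) -` (- epi f)) (at x)"
      by (rule eventually_at_in_open')
    then show "eventually (\<lambda>w. y < f w) (at x)"
      by eventually_elim (use r in \<open>auto simp: epi_def\<close>)
  qed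
qed

lemma convex_fun_iff_convex_epi:
  fixes f :: "'a::real_vector \<Rightarrow> ereal"
  assumes "\<And>x. f x \<noteq> -\<infinity>"
  shows "convex_fun f \<longleftrightarrow> convex (epi f)"
proof
  assume c: "convex_fun f"
  show "convex (epi f)"
    unfolding convex_alt
  proof (intro ballI allI impI, clarify)
    fix x k y l and u :: real
    assume k: "(x, k) \<in> epi f" and l: "(y, l) \<in> epi f" and u: "0 \<le> u" "u \<le> 1"
    show "(1 - u) *\<^sub>R (x, k) + u *\<^sub>R (y, l) \<in> epi f"
    proof (cases "u = 0 \<or> u = 1")
      case True
      then show ?thesis using k l by auto
    next
      case False
      with u have u': "0 < u" "u < 1" by auto
      have "f ((1 - u) *\<^sub>R x + u *\<^sub>R y) \<le> ereal (1 - u) * f x + ereal u * f y"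
        using c u' by (auto simp: convex_fun_def)
      also have "\<dots> \<le> ereal (1 - u) * ereal k + ereal u * ereal l"
        using k l u' by (intro add_mono ereal_mult_left_mono) (auto simp: epi_def)
      finally show ?thesis by (simp add: epi_def)
    qed
  qed
next
  assume c: "convex (epi f)"
  show "convex_fun f"
    unfolding convex_fun_def
  proof (intro allI impI, elim conjE)
    fix x y and u :: real assume u: "0 < u" "u < 1"
    show "f ((1 - u) *\<^sub>R x + u *\<^sub>R y) \<le> ereal (1 - u) * f x + ereal u * f y"
    proof (cases "f x = \<infinity> \<or> f y = \<infinity>")
      case True
      have "ereal (1 - u) * f x + ereal u * f y = \<infinity>"
        using True u assms[of x] assms[of y] by (cases "f x"; cases "f y") auto
      then show ?thesis by (metis ereal_less_eq(1))
    next
      case False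
      then obtain k l where kl: "f x = ereal k" "f y = ereal l"
        using assms[of x] assms[of y] by (cases "f x"; cases "f y") auto
      have "(1 - u) *\<^sub>R (x, k) + u *\<^sub>R (y, l) \<in> epi f"
        using c kl u unfolding convex_alt by (auto simp: epi_def)
      then show ?thesis by (simp add: epi_def kl)
    qed
  qed
qed

lemma Gamma0_iff_epi:
  "f \<in> Gamma0 \<longleftrightarrow> (\<forall>x. f x \<noteq> -\<infinity>) \<and> epi f \<noteq> {} \<and> closed (epi f) \<and> convex (epi f)"
proof -
  have "(\<exists>x. f x \<noteq> \<infinity>) \<longleftrightarrow> epi f \<noteq> {}" if "\<forall>x. f x \<noteq> -\<infinity>"
  proof
    assume "\<exists>x. f x \<noteq> \<infinity>"
    then obtain x where "f x \<noteq> \<infinity>" ..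
    then have "(x, real_of_ereal (f x)) \<in> epi f"
      using that by (cases "f x") (auto simp: epi_def)
    then show "epi f \<noteq> {}" by auto
  next
    assume "epi f \<noteq> {}"
    then obtain x l where "f x \<le> ereal l" by (auto simp: epi_def)
    then have "f x \<noteq> \<infinity>" by auto
    then show "\<exists>x. f x \<noteq> \<infinity>" ..
  qed
  then show ?thesis
    using convex_fun_iff_convex_epi[of f] lsc_fun_iff_closed_epi[of f]
    unfolding Gamma0_def proper_fun_def by auto
qed

lemma Gamma0_ereal:
  assumes "f \<in> Gamma0" "(x, l) \<in> epi f"
  obtains k where "f x = ereal k" "k \<le> l"
  using assms by (cases "f x") (auto simp: epi_def Gamma0_iff_epi)

text \<open>The function is the fibrewise infimum, and closedness makes this infimum attained.
  Fibres may be empty or unbounded below, so infinite values cannot be excluded at this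
  stage.\<close>

lemma epi_fun_exists:
  fixes E :: "('a::metric_space \<times> real) set"
  assumes cl: "closed E" and up: "\<And>x l k. (x, l) \<in> E \<Longrightarrow> l \<le> k \<Longrightarrow> (x, k) \<in> E"
  obtains h where "epi h = E"
proof
  define h where "h x = Inf (ereal ` {l. (x, l) \<in> E})" for x
  show "epi h = E"
  proof (intro equalityI subrelI)
    fix x l assume "(x, l) \<in> epi h"
    then have hx: "h x \<le> ereal l" by (simp add: epi_def)
    \<comment> \<open>A strict margin above the infimum yields a point of the fibre below it;
      letting the margin shrink uses that \<open>E\<close> is closed.\<close>
    have "(x, l + 1 / Suc n) \<in> E" for n
    proof -
      have "h x < ereal (l + 1 / Suc n)"
        using hx by (rule order.strict_trans1) simp
      then obtain k where "(x, k) \<in> E" "k < l + 1 / Suc n"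
        by (auto simp: h_def Inf_less_iff)
      then show ?thesis using up by fastforce
    qed
    moreover have "(\<lambda>n. (x, l + 1 / Suc n)) \<longlonglongrightarrow> (x, l + 0)"
      by (intro tendsto_intros LIMSEQ_Suc[OF lim_1_over_n])
    ultimately show "(x, l) \<in> E"
      using cl unfolding closed_sequential_limits
      by (auto dest!: spec[of _ "\<lambda>n. (x, l + 1 / real (Suc n))"])
  next
    fix x l assume "(x, l) \<in> E"
    then show "(x, l) \<in> epi h" by (auto simp: epi_def h_def intro!: Inf_lower)
  qed
qed

text \<open>Geometric form: a non-vertical affine function of slope \<open>y\<close> touches the
  epigraph at \<open>x\<close> from below. All quantities are real, so the inequality survives
  limits of epigraph points. Finiteness of \<open>f x\<close> follows from testing the subgradient
  at one point of the domain.\<close>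

lemma mem_subdiff_iff_epi:
  assumes f: "f \<in> Gamma0"
  shows "y \<in> subdiff f x \<longleftrightarrow>
    (\<exists>l. f x = ereal l \<and> (\<forall>w k. (w, k) \<in> epi f \<longrightarrow> l + y \<bullet> (w - x) \<le> k))"
proof
  assume y: "y \<in> subdiff f x"
  obtain w k where wk: "(w, k) \<in> epi f" using f by (fastforce simp: Gamma0_iff_epi)
  have ninf: "f x \<noteq> -\<infinity>" using f by (simp add: Gamma0_iff_epi)
  obtain k' where k': "f w = ereal k'" using Gamma0_ereal[OF f wk] .
  have "ereal (y \<bullet> (w - x)) \<le> f w - f x" using y by (simp add: subdiff_def)
  then obtain l where l: "f x = ereal l" using ninf k' by (cases "f x") auto
  have "l + y \<bullet> (w - x) \<le> k" if wk: "(w, k) \<in> epi f" for w k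
  proof -
    obtain k' where k': "f w = ereal k'" "k' \<le> k" using Gamma0_ereal[OF f wk] .
    have "ereal (y \<bullet> (w - x)) \<le> f w - f x" using y by (simp add: subdiff_def)
    then show ?thesis using k' l by simp
  qed
  with l show "\<exists>l. f x = ereal l \<and> (\<forall>w k. (w, k) \<in> epi f \<longrightarrow> l + y \<bullet> (w - x) \<le> k)" by blast
next
  assume "\<exists>l. f x = ereal l \<and> (\<forall>w k. (w, k) \<in> epi f \<longrightarrow> l + y \<bullet> (w - x) \<le> k)"
  then obtain l where l: "f x = ereal l"
    and le: "\<And>w k. (w, k) \<in> epi f \<Longrightarrow> l + y \<bullet> (w - x) \<le> k" by blast
  have "ereal (y \<bullet> (w - x)) \<le> f w - f x" for w
  proof (cases "f w")
    case (real k)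
    then have "l + y \<bullet> (w - x) \<le> k" by (intro le) (simp add: epi_def)
    then show ?thesis using real l by simp
  next
    case MInf
    then show ?thesis using f by (auto simp: Gamma0_iff_epi)
  qed (simp add: l)
  then show "y \<in> subdiff f x" by (simp add: subdiff_def)
qed

lemma subdiffE:
  assumes "f \<in> Gamma0" "y \<in> subdiff f x"
  obtains l where "f x = ereal l" "(x, l) \<in> epi f"
    "\<forall>w k. (w, k) \<in> epi f \<longrightarrow> l + y \<bullet> (w - x) \<le> k"
  using assms mem_subdiff_iff_epi[OF assms(1), of y x] by (auto simp: epi_def)

lemma subdiff_finite:
  assumes "f \<in> Gamma0" "y \<in> subdiff f x"
  shows "\<exists>l. f x = ereal l"
  using assms by (auto simp: mem_subdiff_iff_epi)

lemma subdiff_epi_le: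
  assumes "f \<in> Gamma0" "y \<in> subdiff f x" "f x = ereal l" "(w, k) \<in> epi f"
  shows "l + y \<bullet> (w - x) \<le> k"
  using assms by (auto simp: mem_subdiff_iff_epi)

text \<open>Limit arguments produce some point \<open>(x, l)\<close> of the epigraph, not the value
  of \<open>f\<close>. Testing the tangent inequality at \<open>(x, f x)\<close> forces
  \<open>l\<close> to be that value.\<close>

lemma subdiffI:
  assumes f: "f \<in> Gamma0" and "(x, l) \<in> epi f"
    "\<And>w k. (w, k) \<in> epi f \<Longrightarrow> l + y \<bullet> (w - x) \<le> k"
  shows "y \<in> subdiff f x" "f x = ereal l"
proof -
  obtain k where k: "f x = ereal k" "k \<le> l" using Gamma0_ereal[OF f assms(2)] .
  moreover have "l + y \<bullet> (x - x) \<le> k" by (rule assms(3)) (simp add: epi_def k)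
  ultimately show "f x = ereal l" by simp
  with assms(3) show "y \<in> subdiff f x" by (auto simp: mem_subdiff_iff_epi[OF f])
qed

lemma monotone_subdiff:
  assumes f: "f \<in> Gamma0"
  shows "monotone_operator (subdiff f)"
  unfolding monotone_operator_def
proof (intro allI impI, elim conjE)
  fix x1 y1 x2 y2 assume y: "y1 \<in> subdiff f x1" "y2 \<in> subdiff f x2"
  obtain l1 where "f x1 = ereal l1" and l1: "(x1, l1) \<in> epi f" "\<forall>w k. (w, k) \<in> epi f \<longrightarrow> l1 + y1 \<bullet> (w - x1) \<le> k"
    by (rule subdiffE[OF f y(1)])
  obtain l2 where "f x2 = ereal l2" and l2: "(x2, l2) \<in> epi f" "\<forall>w k. (w, k) \<in> epi f \<longrightarrow> l2 + y2 \<bullet> (w - x2) \<le> k"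
    by (rule subdiffE[OF f y(2)])
  from l1(2)[rule_format, OF l2(1)] l2(2)[rule_format, OF l1(1)] show "0 \<le> (y1 - y2) \<bullet> (x1 - x2)"
    by (simp add: inner_diff_left inner_diff_right)
qed

section \<open>Resolvents\<close>

text \<open>Parallelogram law for \<open>a - u\<close> and \<open>b - u\<close>: the strong
  convexity that makes minimising sequences Cauchy.\<close>

lemma midpoint_norm_identity:
  fixes a b u :: "'a::real_inner"
  shows "(norm ((1/2) *\<^sub>R a + (1/2) *\<^sub>R b - u))\<^sup>2 =
    (norm (a - u))\<^sup>2 / 2 + (norm (b - u))\<^sup>2 / 2 - (norm (a - b))\<^sup>2 / 4"
  unfolding power2_norm_eq_inner
  by (simp add: inner_diff_left inner_diff_right inner_add_left inner_add_right inner_commute field_simps)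

text \<open>Here \<open>p\<close> minimises \<open>k + c * |w - u|^2\<close> over \<open>E\<close>,
  and the conclusion is the first-order optimality condition. The penalty dominates the at most
  linear descent of \<open>E\<close>. A general closed convex set is allowed so that graphs of
  linear functionals and subspaces are covered besides epigraphs.\<close>

lemma prox_exists:
  fixes E :: "('a::{real_inner,complete_space} \<times> real) set"
  assumes ne: "E \<noteq> {}" and cl: "closed E" and cv: "convex E"
    and M: "0 \<le> M" and lb: "\<And>w k. (w, k) \<in> E \<Longrightarrow> b - M * norm w \<le> k" and c: "0 < c"
  obtains p l where "(p, l) \<in> E" "\<forall>w k. (w, k) \<in> E \<longrightarrow> l + 2 * c * ((u - p) \<bullet> (w - p)) \<le> k"
proof -
  define \<psi> where "\<psi> x = snd x + c * (norm (fst x - u))\<^sup>2" for x :: "'a \<times> real"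
  define m where "m = Inf (\<psi> ` E)"
  \<comment> \<open>Completing the square: \<open>c * d^2 - M * d\<close> is smallest at
    \<open>d = M / (2 * c)\<close>, with value \<open>- M^2 / (4 * c)\<close>.\<close>
  have "b - M * norm u - M\<^sup>2 / (4 * c) \<le> \<psi> x" if "x \<in> E" for x
  proof -
    obtain w k where x: "x = (w, k)" by fastforce
    define d where "d = norm (w - u)"
    have "norm w \<le> norm u + d" unfolding d_def by norm
    then have "b - M * (norm u + d) \<le> k"
      using lb[of w k] that x mult_left_mono[OF _ M, of "norm w" "norm u + d"] by force
    moreover have "0 \<le> c * (d - M / (2 * c))\<^sup>2" using c by simp
    moreover have "c * (d - M / (2 * c))\<^sup>2 = c * d\<^sup>2 - M * d + M\<^sup>2 / (4 * c)"
      using c by (simp add: power2_eq_square field_simps)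
    ultimately show ?thesis by (simp add: \<psi>_def x d_def algebra_simps)
  qed
  then have bdd: "bdd_below (\<psi> ` E)" by (auto intro!: bdd_belowI)
  have m_le: "m \<le> \<psi> x" if "x \<in> E" for x
    unfolding m_def using bdd that by (rule cINF_lower)
  have "\<exists>x\<in>E. \<psi> x < m + 1 / real (Suc n)" for n
    using ne bdd cINF_less_iff[OF ne bdd, of "m + 1 / real (Suc n)"] by (simp add: m_def)
  then obtain X where X: "X n \<in> E" "\<psi> (X n) < m + 1 / real (Suc n)" for n by metis
  define w where "w n = fst (X n)" for n
  \<comment> \<open>The midpoint of two nearly optimal points has value at least \<open>m\<close>,
    while strong convexity puts it below their average by \<open>c / 4\<close> times the squared
    distance.\<close>
  have dist: "c * (norm (w i - w j))\<^sup>2 \<le> 2 * (1 / real (Suc i) + 1 / real (Suc j))" for i j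
  proof -
    have "(1/2) *\<^sub>R X i + (1/2) *\<^sub>R X j \<in> E"
      using cv X(1) by (intro convexD) auto
    then have "m \<le> \<psi> ((1/2) *\<^sub>R X i + (1/2) *\<^sub>R X j)" by (rule m_le)
    also have "\<dots> = \<psi> (X i) / 2 + \<psi> (X j) / 2 - c * (norm (w i - w j))\<^sup>2 / 4"
      by (simp add: \<psi>_def w_def midpoint_norm_identity algebra_simps add_divide_distrib)
    finally show ?thesis using X(2)[of i] X(2)[of j] by simp
  qed
  have "Cauchy w"
  proof (rule metric_CauchyI)
    fix e :: real assume e: "0 < e"
    then obtain N where N: "1 / real (Suc N) < c * e\<^sup>2 / 4"
      using c reals_Archimedean[of "c * e\<^sup>2 / 4"] by (auto simp: inverse_eq_divide)
    show "\<exists>N. \<forall>i\<ge>N. \<forall>j\<ge>N. dist (w i) (w j) < e"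
    proof (intro exI allI impI)
      fix i j assume "N \<le> i" "N \<le> j"
      then have "1 / real (Suc i) \<le> 1 / real (Suc N)" "1 / real (Suc j) \<le> 1 / real (Suc N)"
        by (simp_all add: frac_le)
      then have "1 / real (Suc i) + 1 / real (Suc j) < c * e\<^sup>2 / 2" using N by linarith
      with dist[of i j] have "c * (norm (w i - w j))\<^sup>2 < 2 * (c * e\<^sup>2 / 2)"
        by (meson le_less_trans mult_strict_left_mono zero_less_numeral)
      then have "c * (norm (w i - w j))\<^sup>2 < c * e\<^sup>2" by simp
      then have "(norm (w i - w j))\<^sup>2 < e\<^sup>2" using c by simp
      then show "dist (w i) (w j) < e"
        using e by (simp add: dist_norm power2_less_imp_less)
    qed
  qed
  then obtain p where p: "w \<longlonglongrightarrow> p" using Cauchy_convergent convergent_def by blast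
  \<comment> \<open>Only the first components are known to be Cauchy; the heights converge because
    they are the difference of \<open>\<psi> (X n)\<close> and the penalty.\<close>
  have "(\<lambda>n. \<psi> (X n)) \<longlonglongrightarrow> m"
  proof (rule tendsto_sandwich[of "\<lambda>n. m" _ _ "\<lambda>n. m + 1 / real (Suc n)"])
    show "(\<lambda>n. m + 1 / real (Suc n)) \<longlonglongrightarrow> m"
      using tendsto_add[OF tendsto_const LIMSEQ_Suc[OF lim_1_over_n], of m] by simp
  qed (use X m_le in \<open>auto intro!: always_eventually less_imp_le\<close>)
  then have "(\<lambda>n. \<psi> (X n) - c * (norm (w n - u))\<^sup>2) \<longlonglongrightarrow> m - c * (norm (p - u))\<^sup>2"
    by (intro tendsto_intros p)
  then have "(\<lambda>n. (w n, snd (X n))) \<longlonglongrightarrow> (p, m - c * (norm (p - u))\<^sup>2)"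
    by (intro tendsto_Pair p) (simp add: \<psi>_def w_def)
  then have pE: "(p, m - c * (norm (p - u))\<^sup>2) \<in> E"
    by (rule closed_sequentially[OF cl, rotated]) (use X in \<open>simp add: w_def\<close>)
  moreover have "m - c * (norm (p - u))\<^sup>2 + 2 * c * ((u - p) \<bullet> (w - p)) \<le> k" if "(w, k) \<in> E" for w k
  proof -
    let ?l = "m - c * (norm (p - u))\<^sup>2"
    \<comment> \<open>Compare the minimiser with the point at fraction \<open>s\<close> of the way
      to \<open>(w, k)\<close>, divide by \<open>s\<close>, and afterwards let \<open>s\<close> tend
      to 0 so that the quadratic remainder disappears.\<close>
    have ineq: "0 \<le> k - ?l + 2 * c * ((p - u) \<bullet> (w - p)) + s * (c * (norm (w - p))\<^sup>2)"
      if s: "0 < s" "s \<le> 1" for s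
    proof -
      have "(1 - s) *\<^sub>R (p, ?l) + s *\<^sub>R (w, k) \<in> E"
        using cv pE \<open>(w, k) \<in> E\<close> s by (intro convexD) simp_all
      then have "m \<le> \<psi> ((1 - s) *\<^sub>R (p, ?l) + s *\<^sub>R (w, k))" by (rule m_le)
      also have "(1 - s) *\<^sub>R (p, ?l) + s *\<^sub>R (w, k) = (p + s *\<^sub>R (w - p), ?l + s * (k - ?l))"
        by (simp add: algebra_simps)
      also have "\<psi> \<dots> = ?l + s * (k - ?l) + c * (norm (p - u))\<^sup>2
          + 2 * c * s * ((p - u) \<bullet> (w - p)) + c * s\<^sup>2 * (norm (w - p))\<^sup>2"
        unfolding \<psi>_def power2_norm_eq_inner
        by (simp add: inner_diff_left inner_diff_right inner_add_left inner_add_right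
            inner_commute algebra_simps power2_eq_square)
      finally have "0 \<le> s * (k - ?l + 2 * c * ((p - u) \<bullet> (w - p)) + s * (c * (norm (w - p))\<^sup>2))"
        by (simp add: algebra_simps power2_eq_square)
      then show ?thesis using s by (simp add: zero_le_mult_iff)
    qed
    have "((\<lambda>s. k - ?l + 2 * c * ((p - u) \<bullet> (w - p)) + s * (c * (norm (w - p))\<^sup>2))
        \<longlongrightarrow> k - ?l + 2 * c * ((p - u) \<bullet> (w - p)) + 0 * (c * (norm (w - p))\<^sup>2)) (at_right 0)"
      by (intro tendsto_intros)
    moreover have "eventually (\<lambda>s. 0 \<le> k - ?l + 2 * c * ((p - u) \<bullet> (w - p)) + s * (c * (norm (w - p))\<^sup>2))
        (at_right (0::real))"
      unfolding eventually_at_right_field by (intro exI[of _ 1]) (auto intro!: ineq)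
    ultimately have "0 \<le> k - ?l + 2 * c * ((p - u) \<bullet> (w - p)) + 0 * (c * (norm (w - p))\<^sup>2)"
      by (rule tendsto_lowerbound) simp
    then show ?thesis by (simp add: inner_diff_left algebra_simps)
  qed
  ultimately show thesis using that by blast
qed

text \<open>Surjectivity of \<open>c I + \<partial>f\<close> in resolvent form. The penalty weight
  is \<open>c / 2\<close>, whose gradient has factor \<open>c\<close>.\<close>

lemma prox_subdiff_exists:
  fixes f :: "'a::{real_inner,complete_space} \<Rightarrow> ereal"
  assumes f: "f \<in> Gamma0" and lb: "\<And>w. ereal (\<xi> \<bullet> w + \<beta>) \<le> f w" and c: "0 < c"
  obtains p where "c *\<^sub>R (u - p) \<in> subdiff f p"
proof -
  have lbk: "\<beta> - norm \<xi> * norm w \<le> k" if "(w, k) \<in> epi f" for w k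
  proof -
    have "ereal (\<xi> \<bullet> w + \<beta>) \<le> ereal k"
      using lb[of w] that unfolding epi_def by (auto intro: order_trans simp del: ereal_less_eq(3))
    then show ?thesis using Cauchy_Schwarz_ineq2[of \<xi> w] by simp
  qed
  have E: "epi f \<noteq> {}" "closed (epi f)" "convex (epi f)" "0 < c / 2"
    using f c by (auto simp: Gamma0_iff_epi)
  obtain p l where "(p, l) \<in> epi f"
    "\<forall>w k. (w, k) \<in> epi f \<longrightarrow> l + 2 * (c / 2) * ((u - p) \<bullet> (w - p)) \<le> k"
    by (rule prox_exists[OF E(1-3) norm_ge_zero[of \<xi>] lbk E(4), of u])
  then have "c *\<^sub>R (u - p) \<in> subdiff f p" by (intro subdiffI(1)[OF f]) auto
  then show thesis by (rule that)
qed

text \<open>Minty's argument: for \<open>y\<close> in \<open>B x\<close>, split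
  \<open>x + y = p + q\<close> with \<open>q\<close> a subgradient at \<open>p\<close>. Monotonicity
  of \<open>B\<close> gives \<open>- |x - p|^2 \<ge> 0\<close>, so \<open>p = x\<close> and
  \<open>q = y\<close>.\<close>

lemma maximal_monotone_subdiff:
  fixes f :: "'a::{real_inner,complete_space} \<Rightarrow> ereal"
  assumes f: "f \<in> Gamma0" and lb: "\<And>w. ereal (\<xi> \<bullet> w + \<beta>) \<le> f w"
  shows "maximal_monotone (subdiff f)"
  unfolding maximal_monotone_def
proof (rule conjI[OF monotone_subdiff[OF f]], intro allI impI, elim conjE)
  fix B assume B: "monotone_operator B" and sub: "graph_of (subdiff f) \<subseteq> graph_of B"
  have "y \<in> subdiff f x" if y: "y \<in> B x" for x y
  proof -
    obtain p where p: "1 *\<^sub>R (x + y - p) \<in> subdiff f p"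
      using prox_subdiff_exists[OF f lb zero_less_one] .
    then have "x + y - p \<in> B p" using sub by (auto simp: graph_of_def)
    then have "0 \<le> (y - (x + y - p)) \<bullet> (x - p)"
      using B y unfolding monotone_operator_def by blast
    also have "\<dots> = - ((x - p) \<bullet> (x - p))" by (simp add: inner_diff_left inner_diff_right)
    finally have "x = p" using inner_ge_zero[of "x - p"] by simp
    with p show ?thesis by simp
  qed
  with sub show "graph_of B = graph_of (subdiff f)" by (auto simp: graph_of_def)
qed

section \<open>Recovering a convex function from its tangents and from its subdifferential\<close>

lemma mult_inverse_Suc_tendsto_0: "(\<lambda>n. c * (1 / real (Suc n))) \<longlonglongrightarrow> 0"
  using tendsto_mult[OF tendsto_const LIMSEQ_Suc[OF lim_1_over_n], of c] by simp

text \<open>Young's inequality \<open>2 * M * d \<le> M^2 + d^2\<close> lets the left-hand side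
  absorb the linear term.\<close>

lemma square_le_linear_imp_tendsto_0:
  fixes d :: "nat \<Rightarrow> real"
  assumes "\<And>n. real (Suc n) * (d n)\<^sup>2 \<le> C + M * d n"
  shows "d \<longlonglongrightarrow> 0"
proof -
  have bound: "(d n)\<^sup>2 \<le> (2 * C + M\<^sup>2) * (1 / real (Suc n))" for n
  proof -
    have "2 * M * d n \<le> M\<^sup>2 + (d n)\<^sup>2"
      using zero_le_power2[of "M - d n"] by (simp add: power2_diff)
    moreover have "(d n)\<^sup>2 \<le> real (Suc n) * (d n)\<^sup>2" using mult_right_mono[of 1 "real (Suc n)" "(d n)\<^sup>2"] by simp
    ultimately have "real (Suc n) * (d n)\<^sup>2 \<le> 2 * C + M\<^sup>2" using assms[of n] by linarith
    then show ?thesis by (simp add: pos_le_divide_eq mult.commute del: of_nat_Suc)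
  qed
  have "(\<lambda>n. (d n)\<^sup>2) \<longlonglongrightarrow> 0"
  proof (rule tendsto_sandwich)
    show "eventually (\<lambda>n. 0 \<le> (d n)\<^sup>2) sequentially" by simp
    show "eventually (\<lambda>n. (d n)\<^sup>2 \<le> (2 * C + M\<^sup>2) * (1 / real (Suc n))) sequentially"
      using bound by (intro always_eventually allI)
  qed (rule tendsto_const mult_inverse_Suc_tendsto_0)+
  then have "(\<lambda>n. sqrt ((d n)\<^sup>2)) \<longlonglongrightarrow> sqrt 0" by (rule tendsto_real_sqrt)
  then show ?thesis by (simp add: tendsto_rabs_zero_iff)
qed

(* The slopes used are those of the Moreau-Yosida regularisations (n+1)(w - p), whose points p
   tend to w because the affine minorant bounds f p from below. *)
lemma epi_if_above_tangents:
  fixes f :: "'a::{real_inner,complete_space} \<Rightarrow> ereal"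
  assumes f: "f \<in> Gamma0" and lb: "\<And>w. ereal (\<xi> \<bullet> w + \<beta>) \<le> f w"
    and above: "\<And>p q l. q \<in> subdiff f p \<Longrightarrow> f p = ereal l \<Longrightarrow> l + q \<bullet> (w - p) \<le> k"
  shows "(w, k) \<in> epi f"
proof -
  have "\<exists>p. real (Suc n) *\<^sub>R (w - p) \<in> subdiff f p" for n
    by (rule prox_subdiff_exists[OF f lb, of "real (Suc n)" w]) auto
  then obtain P where P: "real (Suc n) *\<^sub>R (w - P n) \<in> subdiff f (P n)" for n by metis
  have "\<exists>l. f (P n) = ereal l" for n using subdiff_finite[OF f P] .
  then obtain l where l: "f (P n) = ereal (l n)" for n by metis
  have ineq: "l n + real (Suc n) * (norm (w - P n))\<^sup>2 \<le> k" for n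
    using above[OF P l] by (simp add: power2_norm_eq_inner)
  have "(\<lambda>n. norm (w - P n)) \<longlonglongrightarrow> 0"
  proof (rule square_le_linear_imp_tendsto_0)
    fix n
    have "\<xi> \<bullet> P n + \<beta> \<le> l n" using lb[of "P n"] l by simp
    moreover have "\<xi> \<bullet> P n = \<xi> \<bullet> w - \<xi> \<bullet> (w - P n)" by (simp add: inner_diff_right)
    moreover have "\<xi> \<bullet> (w - P n) \<le> norm \<xi> * norm (w - P n)" by (rule norm_cauchy_schwarz)
    ultimately show "real (Suc n) * (norm (w - P n))\<^sup>2 \<le> (k - \<xi> \<bullet> w - \<beta>) + norm \<xi> * norm (w - P n)"
      using ineq[of n] by linarith
  qed
  then have "(\<lambda>n. w - P n) \<longlonglongrightarrow> 0" by (rule tendsto_norm_zero_cancel)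
  then have "(\<lambda>n. w - (w - P n)) \<longlonglongrightarrow> w - 0" by (intro tendsto_intros)
  then have "P \<longlonglongrightarrow> w" by simp
  then have "(\<lambda>n. (P n, k)) \<longlonglongrightarrow> (w, k)" by (intro tendsto_intros)
  moreover have "(P n, k) \<in> epi f" for n
  proof -
    have "0 \<le> real (Suc n) * (norm (w - P n))\<^sup>2" by simp
    with ineq[of n] have "l n \<le> k" by linarith
    then show ?thesis by (simp add: epi_def l)
  qed
  ultimately show ?thesis
    using f closed_sequentially[of "epi f" "\<lambda>n. (P n, k)"] unfolding Gamma0_iff_epi by blast
qed

lemma telescope_abs_le:
  fixes D :: "nat \<Rightarrow> real"
  assumes "\<And>i. i < N \<Longrightarrow> \<bar>D (Suc i) - D i\<bar> \<le> e"
  shows "\<bar>D N - D 0\<bar> \<le> real N * e"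
  using assms
proof (induction N)
  case (Suc N)
  then have "\<bar>D N - D 0\<bar> \<le> real N * e" "\<bar>D (Suc N) - D N\<bar> \<le> e" by auto
  then show ?case by (simp add: algebra_simps)
qed simp

(* Along the resolvents of N equidistant points u i of a segment, g - h varies by at most
   |u (i+1) - u i|^2 per step, in total O(1/N). *)
lemma subdiff_eq_imp_diff_eq:
  fixes g h :: "'a::{real_inner,complete_space} \<Rightarrow> ereal"
  assumes g: "g \<in> Gamma0" and h: "h \<in> Gamma0" and lb: "\<And>w. ereal (\<xi> \<bullet> w + \<beta>) \<le> g w"
    and eq: "subdiff g = subdiff h"
    and z: "\<zeta> \<in> subdiff g z" "g z = h z" and q: "q \<in> subdiff g p"
  shows "g p = h p"
proof -
  obtain G0 where G0: "g z = ereal G0" using subdiffE[OF g z(1)] .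
  obtain G1 where G1: "g p = ereal G1" using subdiffE[OF g q] .
  obtain H1 where H1: "h p = ereal H1" using subdiff_finite[OF h] q unfolding eq by blast
  \<comment> \<open>The resolvents of \<open>z + \<zeta>\<close> and \<open>p + q\<close> are
    \<open>z\<close> and \<open>p\<close>, so a segment between these sums leads from the known
    value to the desired one.\<close>
  define L where "L = (p + q) - (z + \<zeta>)"
  have bound: "\<bar>G1 - H1\<bar> \<le> (norm L)\<^sup>2 * (1 / real (Suc n))" for n
  proof -
    define N where "N = Suc n"
    define u where "u i = (z + \<zeta>) + (real i / real N) *\<^sub>R L" for i
    have u0: "u 0 = z + \<zeta>" and uN: "u N = p + q" by (simp_all add: u_def L_def N_def)
    have "N \<noteq> 0" by (simp add: N_def)
    \<comment> \<open>The resolvent is merely chosen, so its two endpoint values are prescribed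
      explicitly.\<close>
    have "\<exists>x. u i - x \<in> subdiff g x \<and> (i = 0 \<longrightarrow> x = z) \<and> (i = N \<longrightarrow> x = p)" for i
    proof (cases "i = 0 \<or> i = N")
      case True
      then show ?thesis using z(1) q u0 uN \<open>N \<noteq> 0\<close> by auto
    next
      case False
      obtain x where "1 *\<^sub>R (u i - x) \<in> subdiff g x"
        using prox_subdiff_exists[OF g lb zero_less_one, of "u i"] .
      then show ?thesis using False by auto
    qed
    then obtain x where x: "u i - x i \<in> subdiff g (x i)" "i = 0 \<longrightarrow> x i = z" "i = N \<longrightarrow> x i = p" for i
      by metis
    have "\<exists>a b. g (x i) = ereal a \<and> h (x i) = ereal b" for i
      using subdiff_finite[OF g x(1)] subdiff_finite[OF h x(1)[unfolded eq]] by blast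
    then obtain a b where a: "g (x i) = ereal (a i)" and b: "h (x i) = ereal (b i)" for i by metis
    have tangent: "a i + (u i - x i) \<bullet> (x j - x i) \<le> a j" "b i + (u i - x i) \<bullet> (x j - x i) \<le> b j" for i j
    proof -
      have "(u i - x i) \<in> subdiff g (x i)" "(u i - x i) \<in> subdiff h (x i)" using x(1)[of i] eq by simp_all
      then have "ereal ((u i - x i) \<bullet> (x j - x i)) \<le> g (x j) - g (x i)"
        "ereal ((u i - x i) \<bullet> (x j - x i)) \<le> h (x j) - h (x i)" by (auto simp: subdiff_def)
      then show "a i + (u i - x i) \<bullet> (x j - x i) \<le> a j" "b i + (u i - x i) \<bullet> (x j - x i) \<le> b j"
        by (simp_all add: a b)
    qed
    have "\<bar>(a (Suc i) - b (Suc i)) - (a i - b i)\<bar> \<le> (norm L / real N)\<^sup>2" if "i < N" for i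
    proof -
      define dx where "dx = x (Suc i) - x i"
      define dq where "dq = (u (Suc i) - x (Suc i)) - (u i - x i)"
      have "a i + (u i - x i) \<bullet> dx \<le> a (Suc i)" "b i + (u i - x i) \<bullet> dx \<le> b (Suc i)"
        "a (Suc i) \<le> a i + (u (Suc i) - x (Suc i)) \<bullet> dx" "b (Suc i) \<le> b i + (u (Suc i) - x (Suc i)) \<bullet> dx"
        using tangent[of i "Suc i"] tangent[of "Suc i" i] unfolding dx_def
        by (simp_all add: inner_diff_right)
      \<comment> \<open>The increments of \<open>g\<close> and \<open>h\<close> lie in the same
        interval, bounded by the two subgradients applied to \<open>dx\<close>; its length is
        \<open>dq \<bullet> dx\<close>.\<close>
      then have "\<bar>(a (Suc i) - b (Suc i)) - (a i - b i)\<bar> \<le> dq \<bullet> dx"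
        unfolding dq_def by (simp add: inner_diff_left abs_le_iff)
      \<comment> \<open>The sum \<open>dq + dx\<close> is the step of \<open>u\<close>, which is
        known, whereas \<open>dq\<close> and \<open>dx\<close> separately are not.\<close>
      also have "\<dots> \<le> (dq + dx) \<bullet> (dq + dx)"
      proof -
        have "0 \<le> dq \<bullet> dx" using \<open>\<bar>_\<bar> \<le> dq \<bullet> dx\<close> by linarith
        then show ?thesis using inner_ge_zero[of dq] inner_ge_zero[of dx]
          by (simp add: inner_add_left inner_add_right inner_commute)
      qed
      also have "dq + dx = (real (Suc i) / real N - real i / real N) *\<^sub>R L"
        by (simp add: dq_def dx_def u_def scaleR_diff_left del: of_nat_Suc)
      also have "\<dots> = (1 / real N) *\<^sub>R L"
        by (simp add: diff_divide_distrib[symmetric])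
      finally show ?thesis by (simp add: power2_norm_eq_inner[symmetric] power_divide)
    qed
    from telescope_abs_le[where D = "\<lambda>i. a i - b i", OF this]
    have "\<bar>(a N - b N) - (a 0 - b 0)\<bar> \<le> real N * (norm L / real N)\<^sup>2" .
    also have "\<dots> = (norm L)\<^sup>2 * (1 / real N)" by (simp add: N_def power2_eq_square)
    finally have "\<bar>(a N - b N) - (a 0 - b 0)\<bar> \<le> (norm L)\<^sup>2 * (1 / real N)" .
    moreover have "a 0 = b 0" using a[of 0] b[of 0] x(2)[of 0] z(2) by simp
    moreover have "a N = G1" "b N = H1" using a[of N] b[of N] x(3)[of N] G1 H1 by simp_all
    ultimately show ?thesis by (simp add: N_def)
  qed
  have "(\<lambda>n. (norm L)\<^sup>2 * (1 / real (Suc n))) \<longlonglongrightarrow> 0"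
    by (rule mult_inverse_Suc_tendsto_0)
  then have "\<bar>G1 - H1\<bar> \<le> 0"
    by (rule Lim_bounded2) (use bound in auto)
  then show ?thesis using G1 H1 by simp
qed

text \<open>With equal values wherever subgradients exist, \<open>g\<close> and \<open>h\<close>
  have the same tangents, and each epigraph consists of the points above all of these.\<close>

lemma subdiff_determines_fun:
  fixes g h :: "'a::{real_inner,complete_space} \<Rightarrow> ereal"
  assumes g: "g \<in> Gamma0" and h: "h \<in> Gamma0"
    and lbg: "\<And>w. ereal (\<xi> \<bullet> w + \<beta>) \<le> g w" and lbh: "\<And>w. ereal (\<xi> \<bullet> w + \<beta>) \<le> h w"
    and eq: "subdiff g = subdiff h" and z: "\<zeta> \<in> subdiff g z" "g z = h z"
  shows "g = h"
proof -
  have val: "g p = h p" if "q \<in> subdiff g p" for p q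
    using subdiff_eq_imp_diff_eq[OF g h lbg eq z that] .
  have "(w, k) \<in> epi g" if "(w, k) \<in> epi h" for w k
  proof (rule epi_if_above_tangents[OF g lbg])
    fix p q l assume q: "q \<in> subdiff g p" "g p = ereal l"
    then show "l + q \<bullet> (w - p) \<le> k"
      using subdiff_epi_le[OF h _ _ that, of q p l] val[of q p] eq by simp
  qed
  moreover have "(w, k) \<in> epi h" if "(w, k) \<in> epi g" for w k
  proof (rule epi_if_above_tangents[OF h lbh])
    fix p q l assume q: "q \<in> subdiff h p" "h p = ereal l"
    then show "l + q \<bullet> (w - p) \<le> k"
      using subdiff_epi_le[OF g _ _ that, of q p l] val[of q p] eq by simp
  qed
  ultimately have "epi g = epi h" by auto
  then show ?thesis by (simp add: epi_inject)
qed

section \<open>Weak convergence\<close>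

text \<open>The representing vector minimises \<open>|w|^2 / 2 - L w\<close>, that is, the penalty
  with \<open>u = 0\<close> and \<open>c = 1 / 2\<close> over the graph of \<open>- L\<close>. The
  optimality inequality at both signs of a direction becomes an equality.\<close>

lemma riesz_representation:
  fixes L :: "'a::{real_inner,complete_space} \<Rightarrow> real"
  assumes L: "bounded_linear L"
  obtains p where "\<And>y. L y = p \<bullet> y"
proof -
  interpret bounded_linear L by (rule L)
  define E where "E = {x. snd x = - L (fst x)}"
  obtain K where K: "0 \<le> K" "\<And>w. norm (L w) \<le> norm w * K" using nonneg_bounded by blast
  have "(0, 0) \<in> E" by (simp add: E_def zero)
  then have ne: "E \<noteq> {}" by blast
  have cl: "closed E"
    unfolding E_def by (intro closed_Collect_eq continuous_intros continuous_on)
  have cv: "convex E" unfolding E_def by (rule convexI) (simp add: add scaleR algebra_simps)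
  have lb: "0 - K * norm w \<le> k" if "(w, k) \<in> E" for w k
    using K(2)[of w] that by (simp add: E_def mult.commute abs_le_iff)
  have half: "(0::real) < 1 / 2" by simp
  obtain p l where pl: "(p, l) \<in> E"
    "\<forall>w k. (w, k) \<in> E \<longrightarrow> l + 2 * (1 / 2) * ((0 - p) \<bullet> (w - p)) \<le> k"
    by (rule prox_exists[OF ne cl cv K(1) lb half])
  have le: "L d \<le> p \<bullet> d" for d
  proof -
    have "(p + d, - L (p + d)) \<in> E" by (simp add: E_def)
    with pl have "l + 2 * (1 / 2) * ((0 - p) \<bullet> (p + d - p)) \<le> - L (p + d)" by blast
    moreover have "l = - L p" using pl(1) by (simp add: E_def)
    ultimately show ?thesis by (simp add: add)
  qed
  have "L y = p \<bullet> y" for y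
    using le[of y] le[of "- y"] by (simp add: neg)
  then show thesis by (rule that)
qed

text \<open>Minimising the squared distance over \<open>V \<times> {0}\<close> gives the projection
  \<open>p\<close> of \<open>y\<close>; the residual \<open>y - p\<close> is orthogonal to
  \<open>V\<close>, hence in \<open>V\<close>, and so is \<open>y\<close>.\<close>

lemma subspace_eq_UNIV_if_orthogonal_subset:
  fixes V :: "'a::{real_inner,complete_space} set"
  assumes V: "subspace V" and cl: "closed V" and orth: "\<And>y. (\<And>v. v \<in> V \<Longrightarrow> y \<bullet> v = 0) \<Longrightarrow> y \<in> V"
  shows "V = UNIV"
proof -
  have "y \<in> V" for y
  proof -
    have ne: "V \<times> {0::real} \<noteq> {}" using subspace_0[OF V] by auto
    have cl': "closed (V \<times> {0::real})" by (intro closed_Times cl closed_singleton)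
    have cv: "convex (V \<times> {0::real})" by (intro convex_Times subspace_imp_convex V convex_singleton)
    have lb: "0 - 0 * norm w \<le> k" if "(w, k) \<in> V \<times> {0::real}" for w k using that by simp
    have half: "(0::real) < 1 / 2" by simp
    obtain p l where pl: "(p, l) \<in> V \<times> {0::real}"
      "\<forall>w k. (w, k) \<in> V \<times> {0::real} \<longrightarrow> l + 2 * (1 / 2) * ((y - p) \<bullet> (w - p)) \<le> k"
      by (rule prox_exists[OF ne cl' cv order_refl lb half])
    then have le: "(y - p) \<bullet> (w - p) \<le> 0" if "w \<in> V" for w using that by auto
    have pV: "p \<in> V" using pl by auto
    have "(y - p) \<bullet> v = 0" if "v \<in> V" for v
      using le[of "p + v"] le[of "p - v"] subspace_add[OF V pV that] subspace_diff[OF V pV that] by simp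
    then have "y - p \<in> V" by (rule orth)
    then show ?thesis using subspace_add[OF V pV] by fastforce
  qed
  then show ?thesis by blast
qed

text \<open>Separability is avoided by diagonalising only against the members of the sequence
  itself: vectors orthogonal to all of them have constant inner products 0. The test vectors with
  convergent inner products form a closed subspace, which is therefore everything.\<close>

lemma weakly_convergent_subsequence:
  fixes X :: "nat \<Rightarrow> 'a::{real_inner,complete_space}"
  assumes bd: "bounded (range X)"
  obtains r x where "strict_mono r" "weakly_tendsto (X \<circ> r) x"
proof -
  obtain M where M: "0 < M" "\<And>n. norm (X n) \<le> M" using bd by (auto simp: bounded_pos)
  have bound: "\<bar>X n \<bullet> y\<bar> \<le> M * norm y" for n y
    using Cauchy_Schwarz_ineq2[of "X n" y] mult_right_mono[OF M(2), of "norm y" n] by simp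
  interpret subseqs "\<lambda>n s. convergent (\<lambda>k. X (s k) \<bullet> X n)"
  proof
    fix n and s :: "nat \<Rightarrow> nat" assume "strict_mono s"
    have "bounded (range (\<lambda>k. X (s k) \<bullet> X n))"
      using bound[of _ "X n"] by (auto simp: bounded_iff)
    then obtain l r where "strict_mono r" "((\<lambda>k. X (s k) \<bullet> X n) \<circ> r) \<longlonglongrightarrow> l"
      using bounded_imp_convergent_subsequence by blast
    then show "\<exists>r'. strict_mono r' \<and> convergent (\<lambda>k. X ((s \<circ> r') k) \<bullet> X n)"
      by (auto simp: o_def convergent_def)
  qed
  define r where "r = diagseq"
  have r: "strict_mono r" unfolding r_def by (rule subseq_diagseq)
  have conv_X: "convergent (\<lambda>k. X (r k) \<bullet> X n)" for n
  proof -
    \<comment> \<open>The diagonal sequence refines the one selected for \<open>X n\<close> only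
      from index \<open>Suc n\<close> on; the initial segment is discarded for convergence.\<close>
    have "convergent (\<lambda>k. X ((diagseq \<circ> ((+) (Suc n))) k) \<bullet> X n)"
    proof (rule diagseq_holds)
      fix r s :: "nat \<Rightarrow> nat" and m
      assume "strict_mono r" "convergent (\<lambda>k. X (s k) \<bullet> X m)"
      from convergent_subseq_convergent[OF this(2,1)]
      show "convergent (\<lambda>k. X ((s \<circ> r) k) \<bullet> X m)" by (simp add: o_def)
    qed
    then have "convergent (\<lambda>k. X (r (k + Suc n)) \<bullet> X n)" by (simp add: r_def o_def add.commute)
    then show ?thesis by (subst (asm) convergent_ignore_initial_segment)
  qed
  define V where "V = {y. convergent (\<lambda>k. X (r k) \<bullet> y)}"
  have "subspace V"
    unfolding V_def subspace_def
    by (auto simp: inner_add_right intro: convergent_add convergent_mult convergent_const)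
  moreover have "closed V"
    unfolding closed_sequential_limits
  proof (intro allI impI, elim conjE)
    fix Y y assume Y: "\<forall>j. Y j \<in> V" and lim: "Y \<longlonglongrightarrow> y"
    have "Cauchy (\<lambda>k. X (r k) \<bullet> y)"
    proof (rule metric_CauchyI)
      fix e :: real assume e: "0 < e"
      then obtain j where j: "norm (Y j - y) < e / (3 * M)"
        using LIMSEQ_D[OF lim, of "e / (3 * M)"] M(1) by auto
      \<comment> \<open>Uniform in \<open>n\<close>, by the norm bound \<open>M\<close>; this is
        what makes the three-term estimate work.\<close>
      have close: "\<bar>X n \<bullet> y - X n \<bullet> Y j\<bar> < e / 3" for n
      proof -
        have "\<bar>X n \<bullet> y - X n \<bullet> Y j\<bar> \<le> M * norm (Y j - y)"
          using bound[of n "y - Y j"] by (simp add: inner_diff_right norm_minus_commute)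
        also have "\<dots> < e / 3" using j M(1) by (simp add: field_simps)
        finally show ?thesis .
      qed
      have "Cauchy (\<lambda>k. X (r k) \<bullet> Y j)" using Y by (auto simp: V_def intro: convergent_Cauchy)
      then obtain N where N: "\<forall>k\<ge>N. \<forall>l\<ge>N. dist (X (r k) \<bullet> Y j) (X (r l) \<bullet> Y j) < e / 3"
        using metric_CauchyD[of _ "e / 3"] e by (metis divide_pos_pos zero_less_numeral)
      show "\<exists>N. \<forall>k\<ge>N. \<forall>l\<ge>N. dist (X (r k) \<bullet> y) (X (r l) \<bullet> y) < e"
      proof (intro exI allI impI)
        fix k l assume "N \<le> k" "N \<le> l"
        then have "\<bar>X (r k) \<bullet> Y j - X (r l) \<bullet> Y j\<bar> < e / 3" using N by (auto simp: dist_real_def)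
        then show "dist (X (r k) \<bullet> y) (X (r l) \<bullet> y) < e"
          using close[of "r k"] close[of "r l"] unfolding dist_real_def by linarith
      qed
    qed
    then show "y \<in> V" by (simp add: V_def Cauchy_convergent)
  qed
  moreover have "y \<in> V" if "\<And>v. v \<in> V \<Longrightarrow> y \<bullet> v = 0" for y
  proof -
    have "X (r k) \<bullet> y = 0" for k
      using that[of "X (r k)"] conv_X by (simp add: V_def inner_commute)
    then show ?thesis by (simp add: V_def convergent_const)
  qed
  ultimately have "V = UNIV" by (rule subspace_eq_UNIV_if_orthogonal_subset)
  then have conv: "(\<lambda>k. X (r k) \<bullet> y) \<longlonglongrightarrow> lim (\<lambda>k. X (r k) \<bullet> y)" for y
    unfolding V_def by (auto simp: convergent_LIMSEQ_iff)
  define L where "L y = lim (\<lambda>k. X (r k) \<bullet> y)" for y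
  have L: "(\<lambda>k. X (r k) \<bullet> y) \<longlonglongrightarrow> L y" for y unfolding L_def by (rule conv)
  have "bounded_linear L"
  proof
    show "L (a + b) = L a + L b" for a b
      using tendsto_add[OF L[of a] L[of b]] L[of "a + b"] by (simp add: inner_add_right LIMSEQ_unique)
    show "L (c *\<^sub>R a) = c *\<^sub>R L a" for c a
      using tendsto_mult_left[OF L[of a], of c] L[of "c *\<^sub>R a"] by (simp add: LIMSEQ_unique)
    have "\<bar>L y\<bar> \<le> M * norm y" for y
      by (rule Lim_bounded[OF tendsto_rabs[OF L]]) (use bound in auto)
    then show "\<exists>K. \<forall>x. norm (L x) \<le> norm x * K" by (auto simp: mult.commute)
  qed
  then obtain x where "\<And>y. L y = x \<bullet> y" using riesz_representation by blast
  with L have "weakly_tendsto (X \<circ> r) x" by (simp add: weakly_tendsto_def)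
  with r show thesis by (rule that)
qed

text \<open>Uniform boundedness principle for the functionals
  \<open>y \<mapsto> X n \<bullet> y\<close>: by Baire, one of the closed sets \<open>F k\<close>
  covering the space contains a ball.\<close>

lemma weakly_tendsto_imp_bounded:
  fixes X :: "nat \<Rightarrow> 'a::{real_inner,complete_space}"
  assumes X: "weakly_tendsto X x"
  shows "bounded (range X)"
proof -
  define F where "F k = {y. \<forall>n. \<bar>X n \<bullet> y\<bar> \<le> real k}" for k :: nat
  have cl: "closed (F k)" for k
    unfolding F_def by (intro closed_Collect_all closed_Collect_le continuous_intros)
  have "\<exists>k. y \<in> F k" for y
  proof -
    have "Bseq (\<lambda>n. X n \<bullet> y)"
      using X unfolding weakly_tendsto_def by (intro convergent_imp_Bseq) (auto simp: convergent_def)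
    then obtain K where K: "\<And>n. \<bar>X n \<bullet> y\<bar> \<le> K" unfolding Bseq_def by auto
    obtain k where "K \<le> real k" using real_arch_simple by blast
    with K show ?thesis unfolding F_def by (auto intro: order_trans)
  qed
  then have "\<Union>(range F) = UNIV" by blast
  moreover have "euclidean interior_of \<Union>(range F) = {}" if "\<And>k. interior (F k) = {}"
    by (rule Baire_category_alt) (use that cl completely_metrizable_space_euclidean in auto)
  ultimately obtain k y0 where "y0 \<in> interior (F k)" by auto
  then obtain e where e: "0 < e" "cball y0 e \<subseteq> F k" using mem_interior_cball by blast
  have "e * norm (X n) \<le> 2 * real k" for n
  proof (cases "X n = 0")
    case False
    \<comment> \<open>The vector of length \<open>e\<close> along \<open>X n\<close>, so that
      \<open>X n \<bullet> y = e * norm (X n)\<close>; the two bounds at \<open>y0 + y\<close> and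
      \<open>y0\<close> give the factor 2.\<close>
    define y where "y = (e / norm (X n)) *\<^sub>R X n"
    have "y0 + y \<in> cball y0 e" "y0 \<in> cball y0 e"
      using e False by (auto simp: dist_norm y_def)
    then have "\<bar>X n \<bullet> (y0 + y)\<bar> \<le> real k" "\<bar>X n \<bullet> y0\<bar> \<le> real k"
      using e(2) unfolding F_def by blast+
    then have "X n \<bullet> y \<le> 2 * real k" by (simp add: inner_add_right)
    also have "X n \<bullet> y = e * norm (X n)"
      using False by (simp add: y_def power2_norm_eq_inner[symmetric] power2_eq_square)
    finally show ?thesis .
  qed simp
  then have "norm (X n) \<le> 2 * real k / e" for n
    using e(1) by (simp add: field_simps)
  then show ?thesis by (auto simp: bounded_iff)
qed

text \<open>Weak against strong convergence: the error \<open>X n \<bullet> (Y n - y)\<close>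
  vanishes because weakly convergent sequences are bounded.\<close>

lemma weakly_tendsto_inner:
  fixes X Y :: "nat \<Rightarrow> 'a::{real_inner,complete_space}"
  assumes X: "weakly_tendsto X x" and Y: "Y \<longlonglongrightarrow> y"
  shows "(\<lambda>n. X n \<bullet> Y n) \<longlonglongrightarrow> x \<bullet> y"
proof -
  obtain M where M: "\<And>n. norm (X n) \<le> M"
    using weakly_tendsto_imp_bounded[OF X] by (auto simp: bounded_iff)
  have "(\<lambda>n. M * norm (Y n - y)) \<longlonglongrightarrow> 0"
    using tendsto_mult_right_zero[OF tendsto_norm_zero[OF LIM_zero[OF Y]]] .
  then have "(\<lambda>n. X n \<bullet> (Y n - y)) \<longlonglongrightarrow> 0"
  proof (rule Lim_null_comparison[rotated], intro always_eventually allI)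
    fix n
    show "norm (X n \<bullet> (Y n - y)) \<le> M * norm (Y n - y)"
      using Cauchy_Schwarz_ineq2[of "X n" "Y n - y"] mult_right_mono[OF M, of "norm (Y n - y)" n] by simp
  qed
  moreover have "(\<lambda>n. X n \<bullet> y) \<longlonglongrightarrow> x \<bullet> y" using X by (simp add: weakly_tendsto_def)
  ultimately have "(\<lambda>n. X n \<bullet> (Y n - y) + X n \<bullet> y) \<longlonglongrightarrow> 0 + x \<bullet> y" by (rule tendsto_add)
  then show ?thesis by (simp add: inner_diff_right)
qed

lemma tendsto_imp_weakly_tendsto: "X \<longlonglongrightarrow> x \<Longrightarrow> weakly_tendsto X x"
  unfolding weakly_tendsto_def by (auto intro: tendsto_intros)

lemma weakly_tendsto_Pair:
  assumes "weakly_tendsto X x" "weakly_tendsto Y y"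
  shows "weakly_tendsto (\<lambda>n. (X n, Y n)) (x, y)"
  unfolding weakly_tendsto_def
proof
  fix z :: "'a \<times> 'b"
  obtain a b where z: "z = (a, b)" by fastforce
  show "(\<lambda>n. (X n, Y n) \<bullet> z) \<longlonglongrightarrow> (x, y) \<bullet> z"
    using assms tendsto_add unfolding weakly_tendsto_def z inner_Pair by blast
qed

lemma weakly_tendsto_fst:
  assumes "weakly_tendsto Z (x, y)"
  shows "weakly_tendsto (\<lambda>n. fst (Z n)) x"
  unfolding weakly_tendsto_def
proof
  fix a
  have "(\<lambda>n. Z n \<bullet> (a, 0)) \<longlonglongrightarrow> (x, y) \<bullet> (a, 0)" using assms unfolding weakly_tendsto_def by blast
  then show "(\<lambda>n. fst (Z n) \<bullet> a) \<longlonglongrightarrow> x \<bullet> a" by (simp add: inner_prod_def)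
qed

lemma weakly_tendsto_snd_real:
  fixes Z :: "nat \<Rightarrow> 'a::real_inner \<times> real"
  assumes "weakly_tendsto Z (x, k)"
  shows "(\<lambda>n. snd (Z n)) \<longlonglongrightarrow> k"
proof -
  have "(\<lambda>n. Z n \<bullet> (0, 1)) \<longlonglongrightarrow> (x, k) \<bullet> (0, 1)" using assms unfolding weakly_tendsto_def by blast
  then show ?thesis by (simp add: inner_prod_def)
qed

section \<open>Lower limits of epigraphs and subdifferentials\<close>

text \<open>The lower limit along one indexing; \<open>set_liminf\<close> is the intersection of
  these over all null sequences. It allows a limit function to be attached to each null sequence
  before these functions are known to agree.\<close>

definition seq_liminf :: "(nat \<Rightarrow> 'a::topological_space set) \<Rightarrow> 'a set" where
  "seq_liminf S = {x. \<exists>X. X \<longlonglongrightarrow> x \<and> (\<exists>N. \<forall>n\<ge>N. X n \<in> S n)}"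

lemma set_liminf_iff_seq_liminf:
  "x \<in> set_liminf S \<longleftrightarrow> (\<forall>t. (\<forall>n. t n > 0) \<and> t \<longlonglongrightarrow> 0 \<longrightarrow> x \<in> seq_liminf (\<lambda>n. S (t n)))"
  by (simp add: set_liminf_def seq_liminf_def)

lemma seq_liminf_subset_set_limsup:
  assumes t: "\<And>n. t n > 0" "t \<longlonglongrightarrow> 0"
  shows "seq_liminf (\<lambda>n. S (t n)) \<subseteq> set_limsup S"
proof
  fix x assume "x \<in> seq_liminf (\<lambda>n. S (t n))"
  then obtain X N where X: "X \<longlonglongrightarrow> x" "\<And>n. n \<ge> N \<Longrightarrow> X n \<in> S (t n)"
    by (auto simp: seq_liminf_def)
  have "(\<lambda>n. X (n + N)) \<longlonglongrightarrow> x" "(\<lambda>n. t (n + N)) \<longlonglongrightarrow> 0"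
    using LIMSEQ_ignore_initial_segment X(1) t(2) by blast+
  then show "x \<in> set_limsup S"
    unfolding set_limsup_def using X(2) t(1)
    by (intro CollectI exI[of _ "\<lambda>n. t (n + N)"] exI[of _ "\<lambda>n. X (n + N)"]) auto
qed

lemma set_limsup_subset_set_wlimsup: "set_limsup S \<subseteq> set_wlimsup S"
  unfolding set_limsup_def set_wlimsup_def using tendsto_imp_weakly_tendsto by blast

lemma set_liminf_subset_set_limsup: "set_liminf S \<subseteq> set_limsup S"
proof -
  define t where "t n = 1 / real (Suc n)" for n
  have t: "\<And>n. 0 < t n" "t \<longlonglongrightarrow> 0"
    using mult_inverse_Suc_tendsto_0[of 1] by (simp_all add: t_def[abs_def])
  have "set_liminf S \<subseteq> seq_liminf (\<lambda>n. S (t n))"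
    using t unfolding set_liminf_iff_seq_liminf subset_iff by blast
  also have "\<dots> \<subseteq> set_limsup S" using t by (rule seq_liminf_subset_set_limsup)
  finally show ?thesis .
qed

text \<open>Quantifying over distances instead of approximating sequences makes closedness a
  triangle inequality, with no diagonal argument.\<close>

lemma seq_liminf_iff_dist:
  fixes S :: "nat \<Rightarrow> 'a::metric_space set"
  shows "x \<in> seq_liminf S \<longleftrightarrow> (\<forall>e>0. \<exists>N. \<forall>n\<ge>N. \<exists>y\<in>S n. dist y x < e)"
proof
  assume "x \<in> seq_liminf S"
  then obtain X N where X: "X \<longlonglongrightarrow> x" "\<And>n. n \<ge> N \<Longrightarrow> X n \<in> S n"
    by (auto simp: seq_liminf_def)
  show "\<forall>e>0. \<exists>N. \<forall>n\<ge>N. \<exists>y\<in>S n. dist y x < e"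
  proof (intro allI impI)
    fix e :: real assume "0 < e"
    then obtain N' where "\<And>n. n \<ge> N' \<Longrightarrow> dist (X n) x < e"
      using X(1) by (meson metric_LIMSEQ_D)
    then show "\<exists>N. \<forall>n\<ge>N. \<exists>y\<in>S n. dist y x < e"
      using X(2) by (intro exI[of _ "max N N'"]) auto
  qed
next
  assume close: "\<forall>e>0. \<exists>N. \<forall>n\<ge>N. \<exists>y\<in>S n. dist y x < e"
  \<comment> \<open>A nearest point may fail to exist, so a nearly nearest one is taken; empty sets,
    which can occur for finitely many \<open>n\<close>, receive an arbitrary value.\<close>
  have "\<exists>y. S n \<noteq> {} \<longrightarrow> y \<in> S n \<and> dist y x < infdist x (S n) + 1 / real (Suc n)" for n
  proof (cases "S n = {}")
    case False
    have "(INF y\<in>S n. dist x y) < infdist x (S n) + 1 / real (Suc n)"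
      using False by (simp add: infdist_notempty)
    then obtain y where "y \<in> S n" "dist x y < infdist x (S n) + 1 / real (Suc n)"
      using cINF_less_iff[OF False bdd_below_image_dist] by blast
    then show ?thesis by (auto simp: dist_commute)
  qed simp
  then obtain X where X: "S n \<noteq> {} \<Longrightarrow> X n \<in> S n \<and> dist (X n) x < infdist x (S n) + 1 / real (Suc n)" for n
    by metis
  obtain N0 where N0: "\<And>n. n \<ge> N0 \<Longrightarrow> S n \<noteq> {}"
    using close[rule_format, of 1] by fastforce
  have "X \<longlonglongrightarrow> x"
  proof (rule metric_LIMSEQ_I)
    fix e :: real assume e: "0 < e"
    then obtain N1 where N1: "\<And>n. n \<ge> N1 \<Longrightarrow> \<exists>y\<in>S n. dist y x < e / 2"
      using close half_gt_zero by blast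
    obtain N2 where N2: "1 / real (Suc N2) < e / 2"
      using reals_Archimedean[of "e / 2"] e by (auto simp: inverse_eq_divide)
    have "dist (X n) x < e" if n: "n \<ge> max N0 (max N1 N2)" for n
    proof -
      obtain y where "y \<in> S n" "dist y x < e / 2" using N1 n by auto
      then have "infdist x (S n) < e / 2" using infdist_le[of y "S n" x] by (simp add: dist_commute)
      moreover have "1 / real (Suc n) \<le> 1 / real (Suc N2)" using n by (simp add: frac_le)
      moreover have "dist (X n) x < infdist x (S n) + 1 / real (Suc n)" using X N0 n by simp
      ultimately show ?thesis using N2 by linarith
    qed
    then show "\<exists>N. \<forall>n\<ge>N. dist (X n) x < e" by blast
  qed
  then show "x \<in> seq_liminf S" unfolding seq_liminf_def using X N0 by blast
qed

lemma closed_seq_liminf: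
  fixes S :: "nat \<Rightarrow> 'a::metric_space set"
  shows "closed (seq_liminf S)"
  unfolding closed_sequential_limits
proof (intro allI impI, elim conjE)
  fix Y y assume Y: "\<forall>j. Y j \<in> seq_liminf S" and lim: "Y \<longlonglongrightarrow> y"
  show "y \<in> seq_liminf S"
    unfolding seq_liminf_iff_dist
  proof (intro allI impI)
    fix e :: real assume "0 < e"
    then have e: "0 < e / 2" by simp
    then obtain j where j: "dist (Y j) y < e / 2" using metric_LIMSEQ_D[OF lim] by blast
    obtain N where N: "\<forall>n\<ge>N. \<exists>a\<in>S n. dist a (Y j) < e / 2"
      using Y e unfolding seq_liminf_iff_dist by blast
    have "dist a y < e" if "dist a (Y j) < e / 2" for a
      using dist_triangle[of a y "Y j"] j that by simp
    with N show "\<exists>N. \<forall>n\<ge>N. \<exists>a\<in>S n. dist a y < e" by meson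
  qed
qed

lemma convex_seq_liminf:
  fixes S :: "nat \<Rightarrow> 'a::real_normed_vector set"
  assumes "\<And>n. convex (S n)"
  shows "convex (seq_liminf S)"
proof (rule convexI)
  fix x y and a b :: real
  assume "x \<in> seq_liminf S" "y \<in> seq_liminf S" and ab: "0 \<le> a" "0 \<le> b" "a + b = 1"
  then obtain X Y N M where X: "X \<longlonglongrightarrow> x" "\<forall>n\<ge>N. X n \<in> S n" and Y: "Y \<longlonglongrightarrow> y" "\<forall>n\<ge>M. Y n \<in> S n"
    by (auto simp: seq_liminf_def)
  have "(\<lambda>n. a *\<^sub>R X n + b *\<^sub>R Y n) \<longlonglongrightarrow> a *\<^sub>R x + b *\<^sub>R y"
    by (intro tendsto_intros X Y)
  moreover have "\<forall>n\<ge>max N M. a *\<^sub>R X n + b *\<^sub>R Y n \<in> S n"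
    using X(2) Y(2) ab by (auto intro!: convexD[OF assms])
  ultimately show "a *\<^sub>R x + b *\<^sub>R y \<in> seq_liminf S"
    unfolding seq_liminf_def by blast
qed

lemma seq_liminf_epi_upward:
  assumes "(x, l) \<in> seq_liminf (\<lambda>n. epi (\<phi> n))" "l \<le> k"
  shows "(x, k) \<in> seq_liminf (\<lambda>n. epi (\<phi> n))"
proof -
  obtain X N where X: "X \<longlonglongrightarrow> (x, l)" "\<forall>n\<ge>N. X n \<in> epi (\<phi> n)"
    using assms(1) by (auto simp: seq_liminf_def)
  have "(\<lambda>n. (fst (X n), snd (X n) + (k - l))) \<longlonglongrightarrow> (fst (x, l), snd (x, l) + (k - l))"
    by (intro tendsto_intros X)
  then have "(\<lambda>n. (fst (X n), snd (X n) + (k - l))) \<longlonglongrightarrow> (x, k)" by simp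
  moreover have "(fst (X n), snd (X n) + (k - l)) \<in> epi (\<phi> n)" if "n \<ge> N" for n
  proof -
    have "\<phi> n (fst (X n)) \<le> ereal (snd (X n))" using X(2) that by (force simp: epi_def)
    also have "\<dots> \<le> ereal (snd (X n) + (k - l))" using assms(2) by simp
    finally show ?thesis by (simp add: epi_def)
  qed
  ultimately show ?thesis unfolding seq_liminf_def by blast
qed

lemma seq_liminf_pairE:
  assumes "(x, y) \<in> seq_liminf S"
  obtains X Y N where "X \<longlonglongrightarrow> x" "Y \<longlonglongrightarrow> y" "\<forall>n\<ge>N. (X n, Y n) \<in> S n"
proof -
  obtain Z N where Z: "Z \<longlonglongrightarrow> (x, y)" "\<forall>n\<ge>N. Z n \<in> S n"
    using assms by (auto simp: seq_liminf_def)
  show thesis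
    by (rule that[of "\<lambda>n. fst (Z n)" "\<lambda>n. snd (Z n)" N])
      (use tendsto_fst[OF Z(1)] tendsto_snd[OF Z(1)] Z(2) in auto)
qed

lemma seq_liminf_pairI:
  assumes "X \<longlonglongrightarrow> x" "Y \<longlonglongrightarrow> y" "\<forall>n\<ge>N. (X n, Y n) \<in> S n"
  shows "(x, y) \<in> seq_liminf S"
  using tendsto_Pair[OF assms(1,2)] assms(3) unfolding seq_liminf_def by blast

text \<open>If convergence fails, some \<open>r\<close> keeps all terms at distance at least
  \<open>e\<close> from \<open>x\<close>, which contradicts any convergent reindexing
  \<open>s\<close>.\<close>

lemma tendsto_if_subsequences:
  fixes X :: "nat \<Rightarrow> 'a::metric_space"
  assumes "\<And>r :: nat \<Rightarrow> nat. strict_mono r \<Longrightarrow> \<exists>s. (\<lambda>n. X (r (s n))) \<longlonglongrightarrow> x"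
  shows "X \<longlonglongrightarrow> x"
proof (rule ccontr)
  assume "\<not> X \<longlonglongrightarrow> x"
  then obtain e where e: "0 < e" and far: "\<And>N. \<exists>n\<ge>N. \<not> dist (X n) x < e"
    unfolding lim_sequentially by blast
  have "infinite {n. \<not> dist (X n) x < e}"
    unfolding infinite_nat_iff_unbounded_le using far by blast
  then obtain r :: "nat \<Rightarrow> nat" where r: "strict_mono r" "\<And>n. \<not> dist (X (r n)) x < e"
    using infinite_enumerate by blast
  obtain s where "(\<lambda>n. X (r (s n))) \<longlonglongrightarrow> x" using assms[OF r(1)] by blast
  then show False using metric_LIMSEQ_D[OF _ e] r(2) by blast
qed

section \<open>Sequences of convex functions with convergent supporting hyperplanes\<close>

locale supported_sequence =
  fixes \<phi> :: "nat \<Rightarrow> 'a::{real_inner,complete_space} \<Rightarrow> ereal"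
    and zs \<xi>s :: "nat \<Rightarrow> 'a" and \<beta>s :: "nat \<Rightarrow> real" and z \<xi> :: 'a and \<beta> :: real
  assumes \<phi>: "\<And>n. \<phi> n \<in> Gamma0"
    and supp: "\<And>n. supporting_hyperplane (\<phi> n) (zs n) (\<xi>s n) (\<beta>s n)"
    and zs: "zs \<longlonglongrightarrow> z" and \<xi>s: "\<xi>s \<longlonglongrightarrow> \<xi>" and \<beta>s: "\<beta>s \<longlonglongrightarrow> \<beta>"
begin

lemma minorant: "ereal (\<xi>s n \<bullet> w + \<beta>s n) \<le> \<phi> n w"
  using supp unfolding supporting_hyperplane_def by blast

lemma supp_subdiff: "\<xi>s n \<in> subdiff (\<phi> n) (zs n)"
proof (rule subdiffI(1)[OF \<phi>])
  show "(zs n, \<xi>s n \<bullet> zs n + \<beta>s n) \<in> epi (\<phi> n)"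
    using supp[of n] by (simp add: epi_def supporting_hyperplane_def)
  fix w k assume "(w, k) \<in> epi (\<phi> n)"
  then have "\<phi> n w \<le> ereal k" by (simp add: epi_def)
  from order_trans[OF minorant this]
  show "\<xi>s n \<bullet> zs n + \<beta>s n + \<xi>s n \<bullet> (w - zs n) \<le> k" by (simp add: inner_diff_right)
qed

text \<open>The affine minorants pass to the limit, so \<open>h\<close> avoids the value minus
  infinity. The contact points of the hyperplanes converge to a point of the limit epigraph, so it
  is nonempty and the limit hyperplane still touches it.\<close>

lemma epi_liminf_exists:
  obtains h where "h \<in> Gamma0" "epi h = seq_liminf (\<lambda>n. epi (\<phi> n))"
    "\<forall>w. ereal (\<xi> \<bullet> w + \<beta>) \<le> h w" "h z = ereal (\<xi> \<bullet> z + \<beta>)" "\<xi> \<in> subdiff h z"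
proof -
  obtain h where h: "epi h = seq_liminf (\<lambda>n. epi (\<phi> n))"
    using epi_fun_exists[OF closed_seq_liminf seq_liminf_epi_upward] .
  have le: "\<xi> \<bullet> w + \<beta> \<le> k" if wk: "(w, k) \<in> epi h" for w k
  proof -
    obtain W K N where W: "W \<longlonglongrightarrow> w" "K \<longlonglongrightarrow> k" "\<forall>n\<ge>N. (W n, K n) \<in> epi (\<phi> n)"
      using seq_liminf_pairE[OF wk[unfolded h]] .
    have "(\<lambda>n. \<xi>s n \<bullet> W n + \<beta>s n) \<longlonglongrightarrow> \<xi> \<bullet> w + \<beta>" by (intro tendsto_intros \<xi>s \<beta>s W)
    then show ?thesis
    proof (rule LIMSEQ_le[OF _ W(2)], intro exI[of _ N] allI impI)
      fix n assume "n \<ge> N"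
      then have "\<phi> n (W n) \<le> ereal (K n)" using W(3) by (simp add: epi_def)
      from order_trans[OF minorant this] show "\<xi>s n \<bullet> W n + \<beta>s n \<le> K n" by simp
    qed
  qed
  have lb: "ereal (\<xi> \<bullet> w + \<beta>) \<le> h w" for w
    by (rule ereal_le_real) (use le in \<open>auto simp: epi_def\<close>)
  have "(\<lambda>n. \<xi>s n \<bullet> zs n + \<beta>s n) \<longlonglongrightarrow> \<xi> \<bullet> z + \<beta>" by (intro tendsto_intros \<xi>s \<beta>s zs)
  then have z: "(z, \<xi> \<bullet> z + \<beta>) \<in> epi h"
    unfolding h using supp
    by (intro seq_liminf_pairI[OF zs, where N = 0]) (auto simp: epi_def supporting_hyperplane_def)
  have "h w \<noteq> -\<infinity>" for w using lb[of w] by auto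
  moreover have "convex (epi h)"
    unfolding h by (rule convex_seq_liminf) (use \<phi> in \<open>auto simp: Gamma0_iff_epi\<close>)
  moreover have "closed (epi h)" unfolding h by (rule closed_seq_liminf)
  ultimately have h0: "h \<in> Gamma0" using z by (auto simp: Gamma0_iff_epi)
  have tangent: "\<xi> \<bullet> z + \<beta> + \<xi> \<bullet> (w - z) \<le> k" if "(w, k) \<in> epi h" for w k
    using le[OF that] by (simp add: inner_diff_right)
  show thesis
    by (rule that[OF h0 h _ subdiffI(2,1)[OF h0 z tangent]]) (use lb in blast)+
qed

end

text \<open>Here \<open>h\<close> is a parameter, so that one function can serve many null sequences
  at once.\<close>

locale epi_liminf_sequence = supported_sequence \<phi> zs \<xi>s \<beta>s z \<xi> \<beta>
  for \<phi> :: "nat \<Rightarrow> 'a::{real_inner,complete_space} \<Rightarrow> ereal" and zs \<xi>s \<beta>s z \<xi> \<beta> +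
  fixes h :: "'a \<Rightarrow> ereal"
  assumes h: "h \<in> Gamma0" and epi_h: "epi h = seq_liminf (\<lambda>n. epi (\<phi> n))"
    and lb_h: "\<And>w. ereal (\<xi> \<bullet> w + \<beta>) \<le> h w"
begin

text \<open>The subgradient inequality of \<open>\<phi> n\<close> at \<open>P n\<close>, tested at a
  recovery sequence of \<open>(w, k)\<close>, bounds the value at \<open>P n\<close> from above. Its
  limit places \<open>(p, k - q \<bullet> (w - p))\<close> in \<open>epi h\<close>, which is the
  subgradient inequality for \<open>h\<close> once \<open>h p\<close> is finite.\<close>

lemma seq_liminf_graph_subset: "seq_liminf (\<lambda>n. graph_of (subdiff (\<phi> n))) \<subseteq> graph_of (subdiff h)"
proof (rule subrelI)
  fix p q assume "(p, q) \<in> seq_liminf (\<lambda>n. graph_of (subdiff (\<phi> n)))"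
  then obtain P Q N where PQ: "P \<longlonglongrightarrow> p" "Q \<longlonglongrightarrow> q" "\<forall>n\<ge>N. (P n, Q n) \<in> graph_of (subdiff (\<phi> n))"
    by (rule seq_liminf_pairE)
  have epi_p: "(p, k - q \<bullet> (w - p)) \<in> epi h" if wk: "(w, k) \<in> epi h" for w k
  proof -
    obtain W K M where W: "W \<longlonglongrightarrow> w" "K \<longlonglongrightarrow> k" "\<forall>n\<ge>M. (W n, K n) \<in> epi (\<phi> n)"
      using seq_liminf_pairE[OF wk[unfolded epi_h]] .
    have "(\<lambda>n. K n - Q n \<bullet> (W n - P n)) \<longlonglongrightarrow> k - q \<bullet> (w - p)" by (intro tendsto_intros PQ W)
    then show ?thesis
      unfolding epi_h
    proof (rule seq_liminf_pairI[OF PQ(1), where N = "max M N"], intro allI impI)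
      fix n assume n: "n \<ge> max M N"
      then have Q: "Q n \<in> subdiff (\<phi> n) (P n)" using PQ(3) by (simp add: graph_of_def)
      obtain l where l: "\<phi> n (P n) = ereal l" using subdiff_finite[OF \<phi> Q] by blast
      have "l + Q n \<bullet> (W n - P n) \<le> K n" using subdiff_epi_le[OF \<phi> Q l] W(3) n by simp
      then show "(P n, K n - Q n \<bullet> (W n - P n)) \<in> epi (\<phi> n)" by (simp add: epi_def l)
    qed
  qed
  obtain w0 k0 where "(w0, k0) \<in> epi h" using h by (fastforce simp: Gamma0_iff_epi)
  then obtain l where l: "h p = ereal l" using Gamma0_ereal[OF h epi_p] by metis
  have "q \<in> subdiff h p"
  proof (rule subdiffI(1)[OF h])
    show "(p, l) \<in> epi h" by (simp add: epi_def l)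
    show "l + q \<bullet> (w - p) \<le> k" if "(w, k) \<in> epi h" for w k
      using epi_p[OF that] by (simp add: epi_def l le_diff_eq)
  qed
  then show "(p, q) \<in> graph_of (subdiff h)" by (simp add: graph_of_def)
qed

text \<open>Tangents of \<open>h\<close> are limits of tangents of \<open>\<phi> n\<close> with
  strongly convergent slopes and base points, so the weakly convergent \<open>W\<close> may be
  inserted into them before passing to the limit.\<close>

lemma weak_limit_in_epi:
  assumes graph: "graph_of (subdiff h) \<subseteq> seq_liminf (\<lambda>n. graph_of (subdiff (\<phi> n)))"
    and W: "weakly_tendsto W w" and K: "K \<longlonglongrightarrow> k" and WK: "\<And>n. (W n, K n) \<in> epi (\<phi> n)"
  shows "(w, k) \<in> epi h"
proof (rule epi_if_above_tangents[OF h lb_h])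
  fix p q l assume q: "q \<in> subdiff h p" and l: "h p = ereal l"
  then have "(p, q) \<in> seq_liminf (\<lambda>n. graph_of (subdiff (\<phi> n)))"
    using graph by (auto simp: graph_of_def)
  then obtain P Q N where PQ: "P \<longlonglongrightarrow> p" "Q \<longlonglongrightarrow> q" "\<forall>n\<ge>N. (P n, Q n) \<in> graph_of (subdiff (\<phi> n))"
    by (rule seq_liminf_pairE)
  have "(\<lambda>n. K n - (W n \<bullet> Q n - Q n \<bullet> P n)) \<longlonglongrightarrow> k - (w \<bullet> q - q \<bullet> p)"
    by (intro tendsto_diff tendsto_inner PQ K weakly_tendsto_inner[OF W])
  then have "(p, k - (w \<bullet> q - q \<bullet> p)) \<in> epi h"
    unfolding epi_h
  proof (rule seq_liminf_pairI[OF PQ(1), where N = N], intro allI impI)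
    fix n assume n: "n \<ge> N"
    then have Q: "Q n \<in> subdiff (\<phi> n) (P n)" using PQ(3) by (simp add: graph_of_def)
    obtain l where l: "\<phi> n (P n) = ereal l" using subdiff_finite[OF \<phi> Q] by blast
    have "l + Q n \<bullet> (W n - P n) \<le> K n" using subdiff_epi_le[OF \<phi> Q l] WK by simp
    then show "(P n, K n - (W n \<bullet> Q n - Q n \<bullet> P n)) \<in> epi (\<phi> n)"
      by (simp add: epi_def l inner_diff_right inner_commute)
  qed
  then show "l + q \<bullet> (w - p) \<le> k"
    by (simp add: epi_def l inner_diff_right inner_commute algebra_simps)
qed

(* Strong convergence of the resolvents: along a subsequence they converge weakly to some p and
   their squared norms to some s; comparing p with the recovery sequence of x in the
   subgradient inequality gives s <= 2 <x, p> - |x|^2, that is |P n - x|^2 tends to 0. *)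
lemma graph_subset_seq_liminf:
  assumes weak: "\<And>(r :: nat \<Rightarrow> nat) W K w k. strict_mono r \<Longrightarrow> weakly_tendsto W w \<Longrightarrow> K \<longlonglongrightarrow> k \<Longrightarrow>
      (\<And>n. (W n, K n) \<in> epi (\<phi> (r n))) \<Longrightarrow> (w, k) \<in> epi h"
  shows "graph_of (subdiff h) \<subseteq> seq_liminf (\<lambda>n. graph_of (subdiff (\<phi> n)))"
proof (rule subrelI)
  fix x y assume "(x, y) \<in> graph_of (subdiff h)"
  then have y: "y \<in> subdiff h x" by (simp add: graph_of_def)
  obtain l where l: "h x = ereal l" using subdiff_finite[OF h y] by blast
  then have "(x, l) \<in> epi h" by (simp add: epi_def)
  then obtain X L N where X: "X \<longlonglongrightarrow> x" and L: "L \<longlonglongrightarrow> l"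
    and XL: "\<forall>n\<ge>N. (X n, L n) \<in> epi (\<phi> n)"
    unfolding epi_h by (rule seq_liminf_pairE)
  \<comment> \<open>With this \<open>u\<close>, the resolvent of \<open>h\<close> at
    \<open>u\<close> is \<open>x\<close>, the expected limit of the resolvents of
    \<open>\<phi> n\<close>.\<close>
  define u where "u = x + y"
  have "\<exists>p. u - p \<in> subdiff (\<phi> n) p" for n
    using prox_subdiff_exists[OF \<phi>[of n] minorant[of n] zero_less_one, of u] by (metis scaleR_one)
  then obtain P where P: "u - P n \<in> subdiff (\<phi> n) (P n)" for n by metis
  \<comment> \<open>Nonexpansiveness: \<open>zs n\<close> is the resolvent of
    \<open>zs n + \<xi>s n\<close>. This yields the uniform bound.\<close>
  have "norm (P n - zs n) \<le> norm (u - zs n - \<xi>s n)" for n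
  proof -
    define d where "d = P n - zs n"
    define a where "a = u - zs n - \<xi>s n"
    have "0 \<le> ((u - P n) - \<xi>s n) \<bullet> (P n - zs n)"
      using monotone_subdiff[OF \<phi>[of n]] P supp_subdiff unfolding monotone_operator_def by blast
    also have "\<dots> = a \<bullet> d - d \<bullet> d"
      by (simp add: a_def d_def inner_diff_left inner_diff_right)
    finally have "norm d * norm d \<le> norm a * norm d"
      using norm_cauchy_schwarz[of a d] by (simp add: power2_norm_eq_inner[symmetric] power2_eq_square)
    then have "norm d \<le> norm a" by (cases "norm d = 0") (auto simp: mult_le_cancel_right)
    then show ?thesis by (simp add: a_def d_def)
  qed
  then have "norm (P n) \<le> norm (zs n) + norm (u - zs n - \<xi>s n)" for n
    using norm_triangle_ineq2[of "P n" "zs n"] by (smt (verit))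
  moreover have "Bseq (\<lambda>n. norm (zs n) + norm (u - zs n - \<xi>s n))"
    by (intro convergent_imp_Bseq convergentI[of _ "norm z + norm (u - z - \<xi>)"] tendsto_intros zs \<xi>s)
  then obtain M where "\<And>n. norm (norm (zs n) + norm (u - zs n - \<xi>s n)) \<le> M"
    unfolding Bseq_def by blast
  ultimately have M: "norm (P n) \<le> M" for n
    by (metis abs_le_iff order_trans real_norm_def)
  have "P \<longlonglongrightarrow> x"
  proof (rule tendsto_if_subsequences)
    fix r :: "nat \<Rightarrow> nat" assume r: "strict_mono r"
    have "bounded (range (P \<circ> r))" using M by (auto simp: bounded_iff)
    then obtain r1 p where r1: "strict_mono r1" "weakly_tendsto (P \<circ> r \<circ> r1) p"
      by (rule weakly_convergent_subsequence)
    have "bounded (range (\<lambda>n. (norm (P (r (r1 n))))\<^sup>2))"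
      using M power_mono[OF M norm_ge_zero, of _ 2] by (auto simp: bounded_iff)
    then obtain s r2 where r2: "strict_mono r2" "((\<lambda>n. (norm (P (r (r1 n))))\<^sup>2) \<circ> r2) \<longlonglongrightarrow> s"
      using bounded_imp_convergent_subsequence by blast
    \<comment> \<open>The shift by \<open>N\<close> keeps all indices in the range where the
      recovery sequence lies in the epigraphs.\<close>
    define \<rho> where "\<rho> n = r (r1 (r2 (n + N)))" for n
    have \<rho>: "strict_mono \<rho>"
      using r r1(1) r2(1) unfolding \<rho>_def strict_mono_def by simp
    have "n + N \<le> \<rho> n" for n
      unfolding \<rho>_def by (meson order_trans r r1(1) r2(1) strict_mono_imp_increasing)
    then have \<rho>N: "N \<le> \<rho> n" for n by (meson add_leE)
    have "strict_mono (\<lambda>n. r2 (n + N))" using r2(1) by (simp add: strict_mono_def)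
    then have w: "weakly_tendsto (\<lambda>n. P (\<rho> n)) p"
      using r1(2) LIMSEQ_subseq_LIMSEQ[of _ _ "\<lambda>n. r2 (n + N)"]
      unfolding weakly_tendsto_def \<rho>_def o_def by blast
    have s: "(\<lambda>n. (norm (P (\<rho> n)))\<^sup>2) \<longlonglongrightarrow> s"
      using LIMSEQ_ignore_initial_segment[OF r2(2), of N] by (simp add: \<rho>_def o_def)
    have X\<rho>: "(\<lambda>n. X (\<rho> n)) \<longlonglongrightarrow> x" and L\<rho>: "(\<lambda>n. L (\<rho> n)) \<longlonglongrightarrow> l"
      using LIMSEQ_subseq_LIMSEQ[OF X \<rho>] LIMSEQ_subseq_LIMSEQ[OF L \<rho>] by (simp_all add: o_def)
    \<comment> \<open>This is \<open>L - (u - P) \<bullet> (X - P)\<close> expanded: the upper bound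
      for the value at \<open>P\<close> given by its subgradient \<open>u - P\<close> tested at
      \<open>X\<close>. Every term of the expansion has a limit, including the weak ones.\<close>
    define K where "K n = L (\<rho> n) - u \<bullet> X (\<rho> n) + P (\<rho> n) \<bullet> (u + X (\<rho> n)) - (norm (P (\<rho> n)))\<^sup>2" for n
    have "K \<longlonglongrightarrow> l - u \<bullet> x + p \<bullet> (u + x) - s"
      unfolding K_def by (intro tendsto_intros X\<rho> L\<rho> s weakly_tendsto_inner[OF w])
    moreover have "(P (\<rho> n), K n) \<in> epi (\<phi> (\<rho> n))" for n
    proof -
      obtain l' where l': "\<phi> (\<rho> n) (P (\<rho> n)) = ereal l'" using subdiff_finite[OF \<phi> P] by blast
      have "(X (\<rho> n), L (\<rho> n)) \<in> epi (\<phi> (\<rho> n))" using XL \<rho>N by blast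
      from subdiff_epi_le[OF \<phi> P l' this] have "l' \<le> K n"
        by (simp add: K_def power2_norm_eq_inner inner_diff_left inner_diff_right inner_add_right inner_commute)
      then show ?thesis by (simp add: epi_def l')
    qed
    ultimately have "(p, l - u \<bullet> x + p \<bullet> (u + x) - s) \<in> epi h" by (rule weak[OF \<rho> w])
    from subdiff_epi_le[OF h y l this] have s_le: "s - 2 * (p \<bullet> x) + x \<bullet> x \<le> 0"
      by (simp add: u_def inner_add_left inner_add_right inner_diff_right inner_commute algebra_simps)
    have "(\<lambda>n. (norm (P (\<rho> n)))\<^sup>2 - 2 * (P (\<rho> n) \<bullet> x) + x \<bullet> x) \<longlonglongrightarrow> s - 2 * (p \<bullet> x) + x \<bullet> x"
      by (intro tendsto_add tendsto_diff tendsto_mult tendsto_const s)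
        (use w in \<open>simp add: weakly_tendsto_def\<close>)
    moreover have "(norm (P (\<rho> n)))\<^sup>2 - 2 * (P (\<rho> n) \<bullet> x) + x \<bullet> x = (norm (P (\<rho> n) - x))\<^sup>2" for n
      by (simp add: power2_norm_eq_inner inner_diff_left inner_diff_right inner_commute)
    ultimately have lim: "(\<lambda>n. (norm (P (\<rho> n) - x))\<^sup>2) \<longlonglongrightarrow> s - 2 * (p \<bullet> x) + x \<bullet> x" by simp
    have "0 \<le> s - 2 * (p \<bullet> x) + x \<bullet> x" by (rule Lim_bounded2[OF lim]) simp
    with s_le lim have "(\<lambda>n. (norm (P (\<rho> n) - x))\<^sup>2) \<longlonglongrightarrow> 0" by simp
    then have "(\<lambda>n. sqrt ((norm (P (\<rho> n) - x))\<^sup>2)) \<longlonglongrightarrow> sqrt 0" by (rule tendsto_real_sqrt)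
    then have "(\<lambda>n. P (\<rho> n) - x) \<longlonglongrightarrow> 0" by (simp add: tendsto_norm_zero_iff)
    then have "(\<lambda>n. P (\<rho> n)) \<longlonglongrightarrow> x" by (rule LIM_zero_cancel)
    then show "\<exists>s. (\<lambda>n. P (r (s n))) \<longlonglongrightarrow> x"
      unfolding \<rho>_def by (intro exI[of _ "\<lambda>n. r1 (r2 (n + N))"])
  qed
  moreover from this have "(\<lambda>n. u - P n) \<longlonglongrightarrow> u - x" by (intro tendsto_intros)
  then have "(\<lambda>n. u - P n) \<longlonglongrightarrow> y" by (simp add: u_def)
  ultimately show "(x, y) \<in> seq_liminf (\<lambda>n. graph_of (subdiff (\<phi> n)))"
    by (rule seq_liminf_pairI[where N = 0]) (use P in \<open>simp add: graph_of_def\<close>)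
qed

end

section \<open>Mosco and graph convergence of families\<close>

lemma graph_of_inject: "graph_of A = graph_of B \<longleftrightarrow> A = B"
  by (auto simp: graph_of_def fun_eq_iff set_eq_iff)

lemma graph_of_G_limit: "graph_of (G_limit A) = set_liminf (\<lambda>\<tau>. graph_of (A \<tau>))"
  by (auto simp: graph_of_def G_limit_def)

lemma G_limit_eqI: "set_liminf (\<lambda>\<tau>. graph_of (A \<tau>)) = graph_of B \<Longrightarrow> G_limit A = B"
  by (simp add: graph_of_inject[symmetric] graph_of_G_limit)

lemma M_limit_fun_eqI: "epi g = set_liminf (\<lambda>\<tau>. epi (f \<tau>)) \<Longrightarrow> M_limit_fun f = g"
  unfolding M_limit_fun_def by (rule the_equality) (auto simp flip: epi_inject)

lemma set_liminf_cong:
  assumes "\<And>\<tau>. \<tau> > 0 \<Longrightarrow> S \<tau> = T \<tau>"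
  shows "set_liminf S = set_liminf T"
  unfolding set_liminf_def by (rule Collect_cong) (use assms in metis)

lemma set_limsup_cong:
  assumes "\<And>\<tau>. \<tau> > 0 \<Longrightarrow> S \<tau> = T \<tau>"
  shows "set_limsup S = set_limsup T"
  unfolding set_limsup_def by (rule Collect_cong) (use assms in metis)

lemma supported_sequence_of_family:
  assumes F: "\<And>\<tau>. \<tau> > 0 \<Longrightarrow> F \<tau> \<in> Gamma0"
    and supp: "convergent_supporting_hyperplane F zf \<xi>f \<beta>f z \<xi> \<beta>"
    and t: "\<forall>n. t n > 0" "t \<longlonglongrightarrow> 0"
  shows "supported_sequence (\<lambda>n. F (t n)) (\<lambda>n. zf (t n)) (\<lambda>n. \<xi>f (t n)) (\<lambda>n. \<beta>f (t n)) z \<xi> \<beta>"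
proof
  have lim: "filterlim t (at_right 0) sequentially"
    unfolding filterlim_at using t by (auto intro!: always_eventually simp: less_le)
  show "(\<lambda>n. zf (t n)) \<longlonglongrightarrow> z" "(\<lambda>n. \<xi>f (t n)) \<longlonglongrightarrow> \<xi>" "(\<lambda>n. \<beta>f (t n)) \<longlonglongrightarrow> \<beta>"
    using supp filterlim_compose[OF _ lim] unfolding convergent_supporting_hyperplane_def by blast+
qed (use F t supp in \<open>auto simp: convergent_supporting_hyperplane_def\<close>)

context
  fixes F :: "real \<Rightarrow> 'a::{real_inner,complete_space} \<Rightarrow> ereal"
    and zf \<xi>f :: "real \<Rightarrow> 'a" and \<beta>f :: "real \<Rightarrow> real" and z \<xi> :: 'a and \<beta> :: real
  assumes F: "\<And>\<tau>. \<tau> > 0 \<Longrightarrow> F \<tau> \<in> Gamma0"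
    and supp: "convergent_supporting_hyperplane F zf \<xi>f \<beta>f z \<xi> \<beta>"
begin

text \<open>Mosco convergence makes the lower limits of the epigraphs along all null sequences
  coincide, so a single \<open>h\<close> serves every sequence.\<close>

lemma M_convergent_imp:
  assumes M: "M_convergent_fun F"
  obtains h where "h \<in> Gamma0" "epi h = set_liminf (\<lambda>\<tau>. epi (F \<tau>))"
    "\<forall>w. ereal (\<xi> \<bullet> w + \<beta>) \<le> h w"
    "G_convergent (\<lambda>\<tau>. subdiff (F \<tau>))" "G_limit (\<lambda>\<tau>. subdiff (F \<tau>)) = subdiff h"
proof -
  have wsub: "set_wlimsup (\<lambda>\<tau>. epi (F \<tau>)) \<subseteq> set_liminf (\<lambda>\<tau>. epi (F \<tau>))"
    using M unfolding M_convergent_fun_def M_convergent_def .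
  have seq_eq: "seq_liminf (\<lambda>n. epi (F (t n))) = set_liminf (\<lambda>\<tau>. epi (F \<tau>))"
    if t: "\<forall>n. t n > 0" "t \<longlonglongrightarrow> 0" for t
    using seq_liminf_subset_set_limsup[of t "\<lambda>\<tau>. epi (F \<tau>)"] wsub t
      set_limsup_subset_set_wlimsup[of "\<lambda>\<tau>. epi (F \<tau>)"]
    by (auto simp: set_liminf_iff_seq_liminf)
  define t0 where "t0 n = 1 / real (Suc n)" for n
  have t0: "\<forall>n. t0 n > 0" "t0 \<longlonglongrightarrow> 0"
    using mult_inverse_Suc_tendsto_0[of 1] by (simp_all add: t0_def[abs_def])
  interpret s0: supported_sequence "\<lambda>n. F (t0 n)" "\<lambda>n. zf (t0 n)" "\<lambda>n. \<xi>f (t0 n)" "\<lambda>n. \<beta>f (t0 n)" z \<xi> \<beta>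
    by (rule supported_sequence_of_family[OF F supp t0])
  obtain h where h: "h \<in> Gamma0" "epi h = set_liminf (\<lambda>\<tau>. epi (F \<tau>))"
    "\<forall>w. ereal (\<xi> \<bullet> w + \<beta>) \<le> h w"
    using s0.epi_liminf_exists seq_eq[OF t0] by metis
  have el: "epi_liminf_sequence (\<lambda>n. F (t n)) (\<lambda>n. zf (t n)) (\<lambda>n. \<xi>f (t n)) (\<lambda>n. \<beta>f (t n)) z \<xi> \<beta> h"
    if t: "\<forall>n. t n > 0" "t \<longlonglongrightarrow> 0" for t
    using supported_sequence_of_family[OF F supp t] h seq_eq[OF t]
    by (auto simp: epi_liminf_sequence_def epi_liminf_sequence_axioms_def)
  have upper: "set_limsup (\<lambda>\<tau>. graph_of (subdiff (F \<tau>))) \<subseteq> graph_of (subdiff h)"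
  proof
    fix pq assume "pq \<in> set_limsup (\<lambda>\<tau>. graph_of (subdiff (F \<tau>)))"
    then obtain t X where t: "\<forall>n. t n > 0" "t \<longlonglongrightarrow> 0"
      and X: "X \<longlonglongrightarrow> pq" "\<forall>n. X n \<in> graph_of (subdiff (F (t n)))"
      unfolding set_limsup_def by blast
    \<comment> \<open>An upper limit of the family is a lower limit along the sequence realising it,
      which reduces the upper inclusion to the sequential one.\<close>
    have "pq \<in> seq_liminf (\<lambda>n. graph_of (subdiff (F (t n))))"
      unfolding seq_liminf_def using X by blast
    then show "pq \<in> graph_of (subdiff h)"
      using epi_liminf_sequence.seq_liminf_graph_subset[OF el[OF t]] by blast
  qed
  have "graph_of (subdiff h) \<subseteq> seq_liminf (\<lambda>n. graph_of (subdiff (F (t n))))"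
    if t: "\<forall>n. t n > 0" "t \<longlonglongrightarrow> 0" for t
  proof (rule epi_liminf_sequence.graph_subset_seq_liminf[OF el[OF t]])
    fix r :: "nat \<Rightarrow> nat" and W K w k
    assume r: "strict_mono r" and W: "weakly_tendsto W w" and K: "K \<longlonglongrightarrow> k"
      and WK: "\<And>n. (W n, K n) \<in> epi (F (t (r n)))"
    have "(\<lambda>n. t (r n)) \<longlonglongrightarrow> 0" using LIMSEQ_subseq_LIMSEQ[OF t(2) r] by (simp add: o_def)
    then have "(w, k) \<in> set_wlimsup (\<lambda>\<tau>. epi (F \<tau>))"
      unfolding set_wlimsup_def
      using t(1) weakly_tendsto_Pair[OF W tendsto_imp_weakly_tendsto[OF K]] WK
      by (intro CollectI exI[of _ "\<lambda>n. t (r n)"] exI[of _ "\<lambda>n. (W n, K n)"]) simp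
    with wsub h(2) show "(w, k) \<in> epi h" by blast
  qed
  then have lower: "graph_of (subdiff h) \<subseteq> set_liminf (\<lambda>\<tau>. graph_of (subdiff (F \<tau>)))"
    unfolding set_liminf_iff_seq_liminf subset_iff by blast
  have "G_convergent (\<lambda>\<tau>. subdiff (F \<tau>))"
    unfolding G_convergent_def PK_convergent_def using upper lower by (rule order_trans)
  moreover have "G_limit (\<lambda>\<tau>. subdiff (F \<tau>)) = subdiff h"
    using upper lower set_liminf_subset_set_limsup by (intro G_limit_eqI) blast
  ultimately show thesis using that h by blast
qed

(* By maximality the lower epi-limit along any null sequence has subdifferential A, and its value
   at z is fixed by the supporting hyperplanes; so it does not depend on the sequence. *)
lemma G_convergent_imp_M_convergent:
  assumes max: "maximal_monotone (G_limit (\<lambda>\<tau>. subdiff (F \<tau>)))"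
  shows "M_convergent_fun F"
proof -
  define A where "A = G_limit (\<lambda>\<tau>. subdiff (F \<tau>))"
  have A: "graph_of A = set_liminf (\<lambda>\<tau>. graph_of (subdiff (F \<tau>)))"
    unfolding A_def by (rule graph_of_G_limit)
  have ex: "\<exists>h. epi_liminf_sequence (\<lambda>n. F (t n)) (\<lambda>n. zf (t n)) (\<lambda>n. \<xi>f (t n)) (\<lambda>n. \<beta>f (t n)) z \<xi> \<beta> h \<and>
      subdiff h = A \<and> h z = ereal (\<xi> \<bullet> z + \<beta>) \<and> \<xi> \<in> subdiff h z"
    if t: "\<forall>n. t n > 0" "t \<longlonglongrightarrow> 0" for t
  proof -
    interpret s: supported_sequence "\<lambda>n. F (t n)" "\<lambda>n. zf (t n)" "\<lambda>n. \<xi>f (t n)" "\<lambda>n. \<beta>f (t n)" z \<xi> \<beta>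
      by (rule supported_sequence_of_family[OF F supp t])
    obtain h where h: "h \<in> Gamma0" "epi h = seq_liminf (\<lambda>n. epi (F (t n)))"
      "\<forall>w. ereal (\<xi> \<bullet> w + \<beta>) \<le> h w" "h z = ereal (\<xi> \<bullet> z + \<beta>)" "\<xi> \<in> subdiff h z"
      by (rule s.epi_liminf_exists)
    interpret e: epi_liminf_sequence "\<lambda>n. F (t n)" "\<lambda>n. zf (t n)" "\<lambda>n. \<xi>f (t n)" "\<lambda>n. \<beta>f (t n)" z \<xi> \<beta> h
      by unfold_locales (use h in auto)
    have "graph_of A \<subseteq> seq_liminf (\<lambda>n. graph_of (subdiff (F (t n))))"
      using t unfolding A subset_iff set_liminf_iff_seq_liminf by blast
    then have "graph_of A \<subseteq> graph_of (subdiff h)" using e.seq_liminf_graph_subset by blast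
    then have "graph_of (subdiff h) = graph_of A"
      using max monotone_subdiff[OF h(1)] unfolding A_def maximal_monotone_def by blast
    then show ?thesis using e.epi_liminf_sequence_axioms h by (auto simp: graph_of_inject)
  qed
  show ?thesis
    unfolding M_convergent_fun_def M_convergent_def
  proof
    fix wk assume "wk \<in> set_wlimsup (\<lambda>\<tau>. epi (F \<tau>))"
    then obtain t X where t: "\<forall>n. t n > 0" "t \<longlonglongrightarrow> 0"
      and X: "weakly_tendsto X wk" "\<forall>n. X n \<in> epi (F (t n))"
      unfolding set_wlimsup_def by blast
    obtain w k where wk: "wk = (w, k)" by fastforce
    obtain h where el: "epi_liminf_sequence (\<lambda>n. F (t n)) (\<lambda>n. zf (t n)) (\<lambda>n. \<xi>f (t n)) (\<lambda>n. \<beta>f (t n)) z \<xi> \<beta> h"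
      and h: "subdiff h = A" "h z = ereal (\<xi> \<bullet> z + \<beta>)" "\<xi> \<in> subdiff h z"
      using ex[OF t] by blast
    have "(w, k) \<in> epi h"
    proof (rule epi_liminf_sequence.weak_limit_in_epi[OF el])
      show "graph_of (subdiff h) \<subseteq> seq_liminf (\<lambda>n. graph_of (subdiff (F (t n))))"
        using t unfolding h(1) A subset_iff set_liminf_iff_seq_liminf by blast
      show "weakly_tendsto (\<lambda>n. fst (X n)) w" "(\<lambda>n. snd (X n)) \<longlonglongrightarrow> k"
        using X(1) unfolding wk by (rule weakly_tendsto_fst, rule weakly_tendsto_snd_real)
      show "(fst (X n), snd (X n)) \<in> epi (F (t n))" for n using X(2) by simp
    qed
    \<comment> \<open>The weak limit was taken along \<open>t\<close>, but the lower limit of the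
      family requires recovery along every \<open>t'\<close>.\<close>
    moreover have "epi h = seq_liminf (\<lambda>n. epi (F (t' n)))"
      if t': "\<forall>n. t' n > 0" "t' \<longlonglongrightarrow> 0" for t'
    proof -
      obtain h' where el': "epi_liminf_sequence (\<lambda>n. F (t' n)) (\<lambda>n. zf (t' n)) (\<lambda>n. \<xi>f (t' n)) (\<lambda>n. \<beta>f (t' n)) z \<xi> \<beta> h'"
        and h': "subdiff h' = A" "h' z = ereal (\<xi> \<bullet> z + \<beta>)" "\<xi> \<in> subdiff h' z"
        using ex[OF t'] by blast
      have "h = h'"
        using epi_liminf_sequence.h[OF el] epi_liminf_sequence.h[OF el']
          epi_liminf_sequence.lb_h[OF el] epi_liminf_sequence.lb_h[OF el'] _ h(3)
        by (rule subdiff_determines_fun) (simp_all add: h h')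
      then show ?thesis using epi_liminf_sequence.epi_h[OF el'] by simp
    qed
    ultimately show "wk \<in> set_liminf (\<lambda>\<tau>. epi (F \<tau>))"
      unfolding wk set_liminf_iff_seq_liminf by blast
  qed
qed

end

section \<open>Second-order difference quotients\<close>

context
  fixes f :: "real \<Rightarrow> 'a::real_inner \<Rightarrow> ereal" and x v :: 'a and \<tau> c :: real
  assumes f: "f \<tau> \<in> Gamma0" and fx: "f \<tau> x = ereal c" and \<tau>: "0 < \<tau>"
begin

text \<open>The epigraph of the quotient is the preimage of \<open>epi (f \<tau>)\<close> under an
  affine map. The infinite values are treated here once; closedness, convexity and the subgradients
  then follow by a change of variables.\<close>

lemma mem_epi_second_diff_quot:
  "(w, k) \<in> epi (second_diff_quot f x v \<tau>) \<longleftrightarrow>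
    (x + \<tau> *\<^sub>R w, \<tau>\<^sup>2 * k + c + \<tau> * (v \<bullet> w)) \<in> epi (f \<tau>)"
proof (cases "f \<tau> (x + \<tau> *\<^sub>R w)")
  case (real a)
  then show ?thesis
    using \<tau> by (simp add: epi_def second_diff_quot_def fx pos_divide_le_eq algebra_simps)
next
  case PInf
  then show ?thesis using \<tau> by (simp add: epi_def second_diff_quot_def fx)
next
  case MInf
  then show ?thesis using f by (simp add: Gamma0_iff_epi)
qed

lemma second_diff_quot_Gamma0: "second_diff_quot f x v \<tau> \<in> Gamma0"
  unfolding Gamma0_iff_epi
proof (intro conjI allI)
  define T where "T p = (x + \<tau> *\<^sub>R fst p, \<tau>\<^sup>2 * snd p + c + \<tau> * (v \<bullet> fst p))" for p :: "'a \<times> real"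
  have epi: "epi (second_diff_quot f x v \<tau>) = T -` epi (f \<tau>)"
    using mem_epi_second_diff_quot by (auto simp: T_def)
  show "second_diff_quot f x v \<tau> w \<noteq> -\<infinity>" for w
  proof
    have "f \<tau> (x + \<tau> *\<^sub>R w) \<noteq> -\<infinity>" using f by (simp add: Gamma0_iff_epi)
    moreover assume "second_diff_quot f x v \<tau> w = -\<infinity>"
    ultimately show False using \<tau>
      by (cases "f \<tau> (x + \<tau> *\<^sub>R w)") (simp_all add: second_diff_quot_def fx)
  qed
  have "(0, 0) \<in> epi (second_diff_quot f x v \<tau>)"
    unfolding mem_epi_second_diff_quot by (simp add: epi_def fx)
  then show "epi (second_diff_quot f x v \<tau>) \<noteq> {}" by blast
  show "closed (epi (second_diff_quot f x v \<tau>))"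
    unfolding epi T_def using f
    by (intro closed_vimage continuous_intros) (simp add: Gamma0_iff_epi)
  show "convex (epi (second_diff_quot f x v \<tau>))"
  proof (rule convexI)
    fix p q and a b :: real
    assume "p \<in> epi (second_diff_quot f x v \<tau>)" "q \<in> epi (second_diff_quot f x v \<tau>)"
      and ab: "0 \<le> a" "0 \<le> b" "a + b = 1"
    then have "a *\<^sub>R T p + b *\<^sub>R T q \<in> epi (f \<tau>)"
      using f ab unfolding epi by (intro convexD) (auto simp: Gamma0_iff_epi)
    also have "a *\<^sub>R T p + b *\<^sub>R T q = T (a *\<^sub>R p + b *\<^sub>R q)"
    proof -
      have "a = 1 - b" using ab by simp
      then show ?thesis
        unfolding T_def by (simp only:) (simp add: inner_add_right algebra_simps)
    qed
    finally show "a *\<^sub>R p + b *\<^sub>R q \<in> epi (second_diff_quot f x v \<tau>)" unfolding epi by simp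
  qed
qed

lemma subdiff_second_diff_quot:
  "y \<in> subdiff (second_diff_quot f x v \<tau>) w \<longleftrightarrow> v + \<tau> *\<^sub>R y \<in> subdiff (f \<tau>) (x + \<tau> *\<^sub>R w)"
proof
  assume y: "y \<in> subdiff (second_diff_quot f x v \<tau>) w"
  obtain l where l: "second_diff_quot f x v \<tau> w = ereal l"
    using subdiff_finite[OF second_diff_quot_Gamma0 y] by blast
  show "v + \<tau> *\<^sub>R y \<in> subdiff (f \<tau>) (x + \<tau> *\<^sub>R w)"
  proof (rule subdiffI(1)[OF f])
    have "(w, l) \<in> epi (second_diff_quot f x v \<tau>)" by (simp add: epi_def l)
    then show "(x + \<tau> *\<^sub>R w, \<tau>\<^sup>2 * l + c + \<tau> * (v \<bullet> w)) \<in> epi (f \<tau>)"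
      unfolding mem_epi_second_diff_quot .
    fix u k assume u: "(u, k) \<in> epi (f \<tau>)"
    \<comment> \<open>Inverse of the affine change of variables, defined since \<open>\<tau>\<close>
      is positive.\<close>
    define w' where "w' = (u - x) /\<^sub>R \<tau>"
    define k' where "k' = (k - c - \<tau> * (v \<bullet> w')) / \<tau>\<^sup>2"
    have u': "u = x + \<tau> *\<^sub>R w'" and k': "k = \<tau>\<^sup>2 * k' + c + \<tau> * (v \<bullet> w')"
      using \<tau> by (simp_all add: w'_def k'_def)
    have "(w', k') \<in> epi (second_diff_quot f x v \<tau>)"
      unfolding mem_epi_second_diff_quot using u u' k' by simp
    then have "l + y \<bullet> (w' - w) \<le> k'" by (rule subdiff_epi_le[OF second_diff_quot_Gamma0 y l])
    then have "\<tau>\<^sup>2 * (l + y \<bullet> (w' - w)) \<le> \<tau>\<^sup>2 * k'" by (rule mult_left_mono) simp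
    then show "\<tau>\<^sup>2 * l + c + \<tau> * (v \<bullet> w) + (v + \<tau> *\<^sub>R y) \<bullet> (u - (x + \<tau> *\<^sub>R w)) \<le> k"
      by (simp add: u' k' inner_add_left inner_diff_right algebra_simps power2_eq_square)
  qed
next
  assume y: "v + \<tau> *\<^sub>R y \<in> subdiff (f \<tau>) (x + \<tau> *\<^sub>R w)"
  obtain a where a: "f \<tau> (x + \<tau> *\<^sub>R w) = ereal a" using subdiff_finite[OF f y] by blast
  define l where "l = (a - c - \<tau> * (v \<bullet> w)) / \<tau>\<^sup>2"
  have a': "a = \<tau>\<^sup>2 * l + c + \<tau> * (v \<bullet> w)" using \<tau> by (simp add: l_def)
  show "y \<in> subdiff (second_diff_quot f x v \<tau>) w"
  proof (rule subdiffI(1)[OF second_diff_quot_Gamma0])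
    show "(w, l) \<in> epi (second_diff_quot f x v \<tau>)"
      unfolding mem_epi_second_diff_quot by (simp add: epi_def a a')
    fix u k assume "(u, k) \<in> epi (second_diff_quot f x v \<tau>)"
    from subdiff_epi_le[OF f y a this[unfolded mem_epi_second_diff_quot]]
    \<comment> \<open>The terms in \<open>v\<close> and \<open>c\<close> cancel on both sides,
      leaving the common factor \<open>\<tau>^2\<close>.\<close>
    have "\<tau>\<^sup>2 * (l + y \<bullet> (u - w)) \<le> \<tau>\<^sup>2 * k"
      by (simp add: a' inner_add_left inner_diff_right algebra_simps power2_eq_square)
    then show "l + y \<bullet> (u - w) \<le> k" using \<tau> by simp
  qed
qed

lemma diff_quot_subdiff: "diff_quot (subdiff_param f) x v \<tau> = subdiff (second_diff_quot f x v \<tau>)"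
proof (intro ext equalityI subsetI)
  fix w y assume "y \<in> subdiff (second_diff_quot f x v \<tau>) w"
  then show "y \<in> diff_quot (subdiff_param f) x v \<tau> w"
    unfolding subdiff_second_diff_quot diff_quot_def subdiff_param_def
    using \<tau> by (intro image_eqI[of _ _ "v + \<tau> *\<^sub>R y"]) simp_all
qed (use \<tau> in \<open>auto simp: subdiff_second_diff_quot diff_quot_def subdiff_param_def\<close>)

end

theorem theorem34:
  fixes f :: "real \<Rightarrow> 'a::{real_inner, complete_space} \<Rightarrow> ereal"
    and x v z \<xi> :: 'a and \<beta> :: real
    and zf \<xi>f :: "real \<Rightarrow> 'a" and \<beta>f :: "real \<Rightarrow> real"
  assumes "f \<in> Gamma0_param"
    and "x \<in> finite_points f"
    and "v \<in> subdiff_param f 0 x"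
    and "convergent_supporting_hyperplane (second_diff_quot f x v) zf \<xi>f \<beta>f z \<xi> \<beta>"
  shows "(twice_epi_differentiable f x v \<longleftrightarrow>
            proto_differentiable (subdiff_param f) x v \<and>
            maximal_monotone (proto_deriv (subdiff_param f) x v)) \<and>
         (twice_epi_differentiable f x v \<longrightarrow>
            second_epi_deriv f x v \<in> Gamma0 \<and>
            ereal \<beta> \<le> second_epi_deriv f x v 0 \<and> second_epi_deriv f x v 0 \<le> 0 \<and>
            proto_deriv (subdiff_param f) x v = subdiff (second_epi_deriv f x v))"
proof -
  define F where "F = second_diff_quot f x v"
  define D where "D = (\<lambda>\<tau>. subdiff (F \<tau>))"
  have f: "f \<tau> \<in> Gamma0" "\<exists>c. f \<tau> x = ereal c" if "\<tau> > 0" for \<tau>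
    using that assms(1,2) less_imp_le unfolding Gamma0_param_def finite_points_def by blast+
  have F: "F \<tau> \<in> Gamma0" if "\<tau> > 0" for \<tau>
    using second_diff_quot_Gamma0 f[OF that] that unfolding F_def by blast
  have supp: "convergent_supporting_hyperplane F zf \<xi>f \<beta>f z \<xi> \<beta>"
    using assms(4) unfolding F_def .
  \<comment> \<open>The identity is available only for positive \<open>\<tau>\<close>, so it is
    transferred through the congruence rules for set limits and not by rewriting the
    families.\<close>
  have D: "graph_of (diff_quot (subdiff_param f) x v \<tau>) = graph_of (D \<tau>)" if "\<tau> > 0" for \<tau>
    using diff_quot_subdiff f[OF that] that unfolding F_def D_def by metis
  have proto: "proto_differentiable (subdiff_param f) x v \<longleftrightarrow> G_convergent D"
    unfolding proto_differentiable_def G_convergent_def PK_convergent_def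
    using set_liminf_cong[OF D] set_limsup_cong[OF D] by simp
  have deriv: "proto_deriv (subdiff_param f) x v = G_limit D"
    unfolding proto_deriv_def G_limit_def using set_liminf_cong[OF D] by simp
  have epi_diff: "twice_epi_differentiable f x v \<longleftrightarrow> M_convergent_fun F"
    by (simp add: twice_epi_differentiable_def F_def)
  have imp: "G_convergent D \<and> maximal_monotone (G_limit D) \<and> second_epi_deriv f x v \<in> Gamma0 \<and>
      ereal \<beta> \<le> second_epi_deriv f x v 0 \<and> second_epi_deriv f x v 0 \<le> 0 \<and>
      G_limit D = subdiff (second_epi_deriv f x v)" if M: "M_convergent_fun F"
  proof -
    obtain h where h: "h \<in> Gamma0" "epi h = set_liminf (\<lambda>\<tau>. epi (F \<tau>))"
      "\<forall>w. ereal (\<xi> \<bullet> w + \<beta>) \<le> h w" "G_convergent D" "G_limit D = subdiff h"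
      unfolding D_def by (rule M_convergent_imp[OF F supp M])
    have "second_epi_deriv f x v = h"
      unfolding second_epi_deriv_def F_def[symmetric] by (rule M_limit_fun_eqI[OF h(2)])
    moreover have "maximal_monotone (subdiff h)"
      using h(1) by (rule maximal_monotone_subdiff) (use h(3) in blast)
    moreover have "ereal \<beta> \<le> h 0" using h(3)[rule_format, of 0] by simp
    moreover have "h 0 \<le> 0"
    proof -
      \<comment> \<open>Every quotient vanishes at the origin, so a constant sequence recovers
        \<open>(0, 0)\<close>.\<close>
      have "(0, 0) \<in> epi (F \<tau>)" if "\<tau> > 0" for \<tau>
        using f[OF that] mem_epi_second_diff_quot[of f \<tau> x _ 0 0 v] that
        by (auto simp: F_def epi_def)
      then have "(0, 0) \<in> epi h"
        unfolding h(2) set_liminf_def by (auto intro!: exI[of _ "\<lambda>_. (0, 0)"])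
      then show ?thesis by (simp add: epi_def zero_ereal_def)
    qed
    ultimately show ?thesis using h by simp
  qed
  have conv: "M_convergent_fun F" if "maximal_monotone (G_limit D)"
    using G_convergent_imp_M_convergent[OF F supp] that unfolding D_def by blast
  show ?thesis
    unfolding epi_diff proto deriv using imp conv by blast
qed

end
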